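(* Let $f(x)=D\log(x)+g(x)$ be a probability density on $(0,2]$, where $D$ is a constant and $g$ is continuous on $[0,2]$. Then $\lim_{n\to\infty}\widehat{T}^n (f\,dx)=f^*\,dx$, in the sense that the continuous densities on $(0,2]$ of the measures $\widehat{T}^n(f\,dx)$ converge to $f^*$ uniformly on compact subsets of $(0,2]$.
   Context: $\mathcal{M}^+$ is the set of bounded non-negative Borel measures on $[0,2]$ and $\langle g,\mu\rangle=\int_0^2 g\,d\mu$ for $g\in C[0,2]$. Define linear operators on $\mathcal{M}^+$ by $$\langle g,U\mu\rangle=\int_{[0,1]}g(2x)\,\mu(dx),\qquad \langle g,V\mu\rangle=\int_{(1,2]}\Big(\frac1{x-1}\int_0^{2(x-1)}g(y)\,dy\Big)\mu(dx),$$ $T=U+V$, and for $\mu\ne0$, $\widehat{T}\mu=\frac{1}{(T\mu)[0,2]}T\mu$. On a measure with density $f$, $T$ acts by $f(x)\mapsto \tfrac12 f(x/2)+\int_{1+x/2}^2\frac{f(y)}{y-1}\,dy$. $f^*$ is the probability density on $(0,2]$ of the form $f^*(t)=\ell^*\log(t)+\sum_{k=0}^\infty a_k^*(t-1)^k$ with $|\ell^*|+\sum_k|a_k^*|<\infty$ which satisfies $$(1+C)f^*(x)=\tfrac12 f^*(x/2)+\int_{1+x/2}^2\frac{f^*(y)}{y-1}\,dy\quad (x\in(0,2]),\qquad C=\int_1^2 f^*(y)\,dy .$$ It exists and is the limit, uniformly on compact subsets of $(0,2]$, of the iteration $(1+C_s)f_{s+1}(x)=\tfrac12 f_s(x/2)+\int_{1+x/2}^2\frac{f_s(y)}{y-1}\,dy$,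 $C_s=\int_1^2f_s$, started from any probability density $f_0(t)=\ell\log(t)+\sum_{k\ge0}a_k(t-1)^k$ with $(\ell,a_0,a_1,\dots)\in\ell^1$. *)

theory Defs
  imports "HOL-Analysis.Analysis"
begin

definition Mplus :: "real measure set" where
  "Mplus = {\<mu>. space \<mu> = {0..2} \<and> sets \<mu> = sets (restrict_space borel {0..2}) \<and> finite_measure \<mu>}"

definition pairing :: "(real \<Rightarrow> real) \<Rightarrow> real measure \<Rightarrow> real" where
  "pairing g \<mu> = (LINT x|\<mu>. g x)"

text \<open>The operators U and V are defined by duality; existence and uniqueness of the
  measures described are proved below (\<open>op_U_well_defined\<close>, \<open>op_V_well_defined\<close>).\<close>

definition op_U :: "real measure \<Rightarrow> real measure" where
  "op_U \<mu> = (THE \<nu>. \<nu> \<in> Mplus \<and> (\<forall>g. continuous_on {0..2} g \<longrightarrow>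
     pairing g \<nu> = (LINT x:{0..1}|\<mu>. g (2 * x))))"

definition op_V :: "real measure \<Rightarrow> real measure" where
  "op_V \<mu> = (THE \<nu>. \<nu> \<in> Mplus \<and> (\<forall>g. continuous_on {0..2} g \<longrightarrow>
     pairing g \<nu> = (LINT x:{1<..2}|\<mu>. 1 / (x - 1) * (LBINT y:{0..2 * (x - 1)}. g y))))"

definition op_T :: "real measure \<Rightarrow> real measure" where
  "op_T \<mu> = measure_of {0..2} (sets (restrict_space borel {0..2}))
     (\<lambda>A. emeasure (op_U \<mu>) A + emeasure (op_V \<mu>) A)"

text \<open>Only meaningful for \<open>\<mu> \<noteq> 0\<close>; the zero measure is mapped to itself.\<close>

definition op_That :: "real measure \<Rightarrow> real measure" where
  "op_That \<mu> = scale_measure (1 / emeasure (op_T \<mu>) {0..2}) (op_T \<mu>)"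

text \<open>The measure \<open>f dx\<close> on \<open>[0,2]\<close>, for \<open>f\<close> given on \<open>(0,2]\<close>; the value at the null point 0,
  where \<open>f\<close> may be unbounded, plays no role.\<close>

definition dens_measure :: "(real \<Rightarrow> real) \<Rightarrow> real measure" where
  "dens_measure f = density (restrict_space lborel {0..2}) (\<lambda>x. ennreal (f x))"

definition prob_density :: "(real \<Rightarrow> real) \<Rightarrow> bool" where
  "prob_density f \<longleftrightarrow> (\<forall>x\<in>{0<..2}. 0 \<le> f x) \<and> set_integrable lborel {0<..2} f \<and>
     (LBINT x:{0<..2}. f x) = 1"

text \<open>The nonnegativity clause is needed since \<^const>\<open>ennreal\<close> truncates negative values to 0.\<close>

definition continuous_density :: "(real \<Rightarrow> real) \<Rightarrow> real measure \<Rightarrow> bool" where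
  "continuous_density h \<mu> \<longleftrightarrow> continuous_on {0<..2} h \<and> (\<forall>x\<in>{0<..2}. 0 \<le> h x) \<and>
     \<mu> = dens_measure h"

definition is_fstar :: "(real \<Rightarrow> real) \<Rightarrow> bool" where
  "is_fstar fs \<longleftrightarrow> prob_density fs \<and>
     (\<exists>l a. summable (\<lambda>k. \<bar>a k\<bar>) \<and>
        (\<forall>t\<in>{0<..2}. fs t = l * ln t + (\<Sum>k. a k * (t - 1) ^ k))) \<and>
     (\<forall>x\<in>{0<..2}. (1 + (LBINT y:{1..2}. fs y)) * fs x =
        1/2 * fs (x / 2) + (LBINT y:{1 + x / 2..2}. fs y / (y - 1)))"


lemma Mplus_eqI:
  assumes M: "M \<in> Mplus" and N: "N \<in> Mplus"
    and eq: "\<And>g. continuous_on {0..2} g \<Longrightarrow> pairing g M = pairing g N"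
  shows "M = N"
proof -
  interpret M: finite_measure M using M by (simp add: Mplus_def)
  interpret N: finite_measure N using N by (simp add: Mplus_def)
  have [simp]: "space M = {0..2}" "space N = {0..2}" using M N by (auto simp: Mplus_def)
  have sM: "sets M = sets (restrict_space borel {0..2})"
    and sN: "sets N = sets (restrict_space borel {0..2})" using M N by (auto simp: Mplus_def)
  have bM: "borel_measurable M = (borel_measurable (restrict_space borel {0..2}) :: (real \<Rightarrow> real) set)"
    and bN: "borel_measurable N = (borel_measurable (restrict_space borel {0..2}) :: (real \<Rightarrow> real) set)"
    by (auto intro!: measurable_cong_sets sM sN)
  have idM: "(\<lambda>x. x) \<in> borel_measurable M" and idN: "(\<lambda>x. x) \<in> borel_measurable N"
    unfolding bM bN by (auto intro: measurable_restrict_space1)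
  define s where "s = (\<lambda>a (k::nat) (x::real). min 1 (max 0 (real k * (x - a))))"
  have lim: "(\<lambda>k. pairing (s a k) P) \<longlonglongrightarrow> measure P ({a<..} \<inter> {0..2})"
    if P: "P \<in> Mplus" for a P
  proof -
    interpret P: finite_measure P using P by (simp add: Mplus_def)
    have sp: "space P = {0..2}" and sP: "sets P = sets (restrict_space borel {0..2})"
      using P by (auto simp: Mplus_def)
    have bP: "borel_measurable P = (borel_measurable (restrict_space borel {0..2}) :: (real \<Rightarrow> real) set)"
      by (auto intro!: measurable_cong_sets sP)
    have mA: "{a<..} \<inter> {0..2} \<in> sets P"
      unfolding sP by (auto simp: sets_restrict_space)
    have "(\<lambda>k. LINT x|P. s a k x) \<longlonglongrightarrow> (LINT x|P. indicator ({a<..} \<inter> {0..2}) x)"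
    proof (rule integral_dominated_convergence[where w = "\<lambda>_. 1"])
      show "(indicator ({a<..} \<inter> {0..2}) :: real \<Rightarrow> real) \<in> borel_measurable P"
        using mA by simp
      show "s a k \<in> borel_measurable P" for k
        unfolding bP s_def by (intro measurable_restrict_space1) measurable
      show "integrable P (\<lambda>_. 1::real)" by simp
      show "AE x in P. (\<lambda>k. s a k x) \<longlonglongrightarrow> indicator ({a<..} \<inter> {0..2}) x"
      proof (rule AE_I2)
        fix x assume x: "x \<in> space P"
        show "(\<lambda>k. s a k x) \<longlonglongrightarrow> indicator ({a<..} \<inter> {0..2}) x"
        proof (cases "x > a")
          case True
          obtain k0 :: nat where k0: "1 / (x - a) < real k0" using reals_Archimedean2 by blast
          have "s a k x = 1" if "k \<ge> k0" for k
          proof -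
            have "1 / (x - a) \<le> real k" using k0 that by linarith
            then have "1 \<le> real k * (x - a)" using True by (simp add: field_simps)
            then show ?thesis by (simp add: s_def)
          qed
          then have "\<forall>\<^sub>F k in sequentially. s a k x = 1"
            by (auto simp: eventually_sequentially)
          then show ?thesis using True x sp by (simp add: tendsto_eventually)
        next
          case False
          then have "real k * (x - a) \<le> 0" for k
            by (simp add: mult_nonneg_nonpos)
          then have "s a k x = 0" for k
            by (simp add: s_def max_absorb1)
          then show ?thesis using False by simp
        qed
      qed
      show "AE x in P. norm (s a k x) \<le> 1" for k
        by (auto simp: s_def)
    qed
    then show ?thesis using mA sp by (simp add: pairing_def Int_absorb2)
  qed
  have meas: "measure M ({a<..} \<inter> {0..2}) = measure N ({a<..} \<inter> {0..2})" for a
  proof -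
    have "pairing (s a k) M = pairing (s a k) N" for k
      by (rule eq) (auto simp: s_def intro!: continuous_intros)
    then show ?thesis using lim[OF M, of a] lim[OF N, of a] LIMSEQ_unique by simp
  qed
  have "distr M borel (\<lambda>x. x) = distr N borel (\<lambda>x. x)"
  proof (rule measure_eqI_lessThan)
    show "emeasure (distr M borel (\<lambda>x. x)) {x<..} < \<infinity>" for x
      using idM by (simp add: emeasure_distr less_top[symmetric])
    show "emeasure (distr M borel (\<lambda>x. x)) {x<..} = emeasure (distr N borel (\<lambda>x. x)) {x<..}" for x
      using idM idN meas[of x]
      by (simp add: emeasure_distr M.emeasure_eq_measure N.emeasure_eq_measure)
  qed auto
  then have e: "emeasure (distr M borel (\<lambda>x. x)) B = emeasure (distr N borel (\<lambda>x. x)) B" for B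
    by simp
  show ?thesis
  proof (rule measure_eqI)
    fix A assume "A \<in> sets M"
    then obtain B where B: "B \<in> sets borel" "A = {0..2} \<inter> B"
      unfolding sM sets_restrict_space by auto
    show "emeasure M A = emeasure N A"
      using e[of B] B idM idN by (simp add: emeasure_distr Int_commute)
  qed (simp add: sM sN)
qed

lemma op_U_ex1:
  assumes M: "\<mu> \<in> Mplus"
  shows "\<exists>!\<nu>. \<nu> \<in> Mplus \<and> (\<forall>g. continuous_on {0..2} g \<longrightarrow>
     pairing g \<nu> = (LINT x:{0..1}|\<mu>. g (2 * x)))"
proof (rule ex_ex1I)
  interpret finite_measure \<mu> using M by (simp add: Mplus_def)
  have sp: "space \<mu> = {0..2}" and s: "sets \<mu> = sets (restrict_space borel {0..2})"
    using M by (auto simp: Mplus_def)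
  define R where "R = restrict_space \<mu> {0..1}"
  have in1: "{0..1} \<inter> space \<mu> \<in> sets \<mu>"
    unfolding s sp by (auto simp: sets_restrict_space)
  have sR: "sets R = sets (restrict_space borel {0..1})"
    unfolding R_def by (subst sets_restrict_space, subst s) (auto simp: sets_restrict_space image_image
        intro!: image_cong)
  have spR: "space R = {0..1}" unfolding R_def by (simp add: space_restrict_space sp Int_absorb2)
  have m: "(\<lambda>x. 2 * x) \<in> measurable R (restrict_space borel {0..2})"
  proof (rule measurable_restrict_space2)
    show "(\<lambda>x. 2 * x) \<in> borel_measurable R"
      unfolding measurable_cong_sets[OF sR refl] by (intro measurable_restrict_space1) measurable
  qed (simp add: spR)
  have fR: "finite_measure R" unfolding R_def using in1
    by (intro finite_measure_restrict_space finite_measure_axioms) (simp add: sp Int_absorb2)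
  define \<nu> where "\<nu> = distr R (restrict_space borel {0..2}) (\<lambda>x. 2 * x)"
  have "\<nu> \<in> Mplus" unfolding Mplus_def \<nu>_def
    using finite_measure.finite_measure_distr[OF fR m] by (simp add: space_restrict_space)
  moreover have "pairing g \<nu> = (LINT x:{0..1}|\<mu>. g (2 * x))" if g: "continuous_on {0..2} g" for g
  proof -
    have "pairing g \<nu> = (LINT x|R. g (2 * x))"
      unfolding pairing_def \<nu>_def
      by (rule integral_distr[OF m]) (rule borel_measurable_continuous_on_restrict[OF g])
    also have "\<dots> = (LINT x:{0..1}|\<mu>. g (2 * x))"
      unfolding R_def set_lebesgue_integral_def by (rule integral_restrict_space[OF in1])
    finally show ?thesis .
  qed
  ultimately show "\<exists>\<nu>. \<nu> \<in> Mplus \<and> (\<forall>g. continuous_on {0..2} g \<longrightarrow>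
     pairing g \<nu> = (LINT x:{0..1}|\<mu>. g (2 * x)))" by blast
qed (auto intro: Mplus_eqI)

text \<open>Existence for V: push the product of \<open>\<mu>\<close> restricted to \<open>(1,2]\<close> with Lebesgue measure
  on \<open>[0,2]\<close> forward along \<open>(x, t) \<mapsto> t (x - 1)\<close>.\<close>

lemma op_V_ex1:
  assumes M: "\<mu> \<in> Mplus"
  shows "\<exists>!\<nu>. \<nu> \<in> Mplus \<and> (\<forall>g. continuous_on {0..2} g \<longrightarrow>
     pairing g \<nu> = (LINT x:{1<..2}|\<mu>. 1 / (x - 1) * (LBINT y:{0..2 * (x - 1)}. g y)))"
proof (rule ex_ex1I)
  interpret finite_measure \<mu> using M by (simp add: Mplus_def)
  have sp: "space \<mu> = {0..2}" and s: "sets \<mu> = sets (restrict_space borel {0..2})"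
    using M by (auto simp: Mplus_def)
  define R where "R = restrict_space \<mu> {1<..2}"
  define L where "L = restrict_space lborel {0..2::real}"
  have in1: "{1<..2} \<inter> space \<mu> \<in> sets \<mu>"
    unfolding s sp by (auto simp: sets_restrict_space)
  have sR: "sets R = sets (restrict_space borel {1<..2})"
    unfolding R_def by (subst sets_restrict_space, subst s) (auto simp: sets_restrict_space image_image
        intro!: image_cong)
  have spR: "space R = {1<..2}" unfolding R_def by (auto simp add: space_restrict_space sp)
  have sL: "sets L = sets (restrict_space borel {0..2})" and spL: "space L = {0..2}"
    unfolding L_def by (auto simp: sets_restrict_space space_restrict_space)
  interpret R: finite_measure R unfolding R_def using in1
    by (intro finite_measure_restrict_space finite_measure_axioms) (simp add: sp Int_absorb2 greaterThanAtMost_subseteq_atLeastAtMost_iff)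
  interpret L: finite_measure L
    by (rule finite_measureI) (simp add: spL, simp add: L_def emeasure_restrict_space)
  interpret RL: pair_sigma_finite R L ..
  interpret RLf: finite_measure "R \<Otimes>\<^sub>M L" by (rule finite_measure_pair_measure) unfold_locales
  have [measurable]: "(\<lambda>x. x) \<in> borel_measurable R" "(\<lambda>x. x) \<in> borel_measurable L"
    unfolding measurable_cong_sets[OF sR refl] measurable_cong_sets[OF sL refl]
    by (auto intro: measurable_restrict_space1)
  have [measurable]: "fst \<in> borel_measurable (R \<Otimes>\<^sub>M L)" "snd \<in> borel_measurable (R \<Otimes>\<^sub>M L)"
    using measurable_compose[OF measurable_fst[of R L] \<open>(\<lambda>x. x) \<in> borel_measurable R\<close>]
      measurable_compose[OF measurable_snd[of R L] \<open>(\<lambda>x. x) \<in> borel_measurable L\<close>] by simp_all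
  have m: "(\<lambda>p. snd p * (fst p - 1)) \<in> measurable (R \<Otimes>\<^sub>M L) (restrict_space borel {0..2})"
  proof (rule measurable_restrict_space2)
    have "0 \<le> t * (x - 1) \<and> t * (x - 1) \<le> 2" if "1 < x" "x \<le> 2" "0 \<le> t" "t \<le> 2" for x t :: real
      using mult_mono[of t 2 "x - 1" 1] that by simp
    then show "(\<lambda>p. snd p * (fst p - 1)) \<in> space (R \<Otimes>\<^sub>M L) \<rightarrow> {0..2}"
      by (auto simp: space_pair_measure spR spL)
  qed measurable
  define \<nu> where "\<nu> = distr (R \<Otimes>\<^sub>M L) (restrict_space borel {0..2}) (\<lambda>p. snd p * (fst p - 1))"
  have "\<nu> \<in> Mplus" unfolding Mplus_def \<nu>_def
    using RLf.finite_measure_distr[OF m] by (simp add: space_restrict_space)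
  moreover have "pairing g \<nu> = (LINT x:{1<..2}|\<mu>. 1 / (x - 1) * (LBINT y:{0..2 * (x - 1)}. g y))"
    if g: "continuous_on {0..2} g" for g
  proof -
    have bg: "g \<in> borel_measurable (restrict_space borel {0..2})"
      by (rule borel_measurable_continuous_on_restrict[OF g])
    obtain B where B: "\<And>y. y \<in> {0..2} \<Longrightarrow> norm (g y) \<le> B"
      using compact_imp_bounded[OF compact_continuous_image[OF g compact_Icc]]
      unfolding bounded_iff by fast
    have int: "integrable (R \<Otimes>\<^sub>M L) (\<lambda>p. g (snd p * (fst p - 1)))"
    proof (rule RLf.integrable_const_bound[where B = B])
      show "(\<lambda>p. g (snd p * (fst p - 1))) \<in> borel_measurable (R \<Otimes>\<^sub>M L)"
        by (rule measurable_compose[OF m bg])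
      show "AE p in R \<Otimes>\<^sub>M L. norm (g (snd p * (fst p - 1))) \<le> B"
        using measurable_space[OF m] by (intro AE_I2 B) (simp add: space_restrict_space)
    qed
    have inner: "(LINT t|L. g (t * (x - 1))) = 1 / (x - 1) * (LBINT y:{0..2 * (x - 1)}. g y)"
      if x: "x \<in> {1<..2}" for x
    proof -
      have "(LBINT y:{0..2 * (x - 1)}. g y)
          = (LBINT y. indicator {0..2 * (x - 1)} y *\<^sub>R g y)"
        by (simp add: set_lebesgue_integral_def)
      also have "\<dots> = \<bar>x - 1\<bar> *\<^sub>R (LBINT t. indicator {0..2 * (x - 1)} (0 + (x - 1) * t) *\<^sub>R g (0 + (x - 1) * t))"
        by (rule lborel_integral_real_affine) (use x in simp)
      also have "(\<lambda>t. indicator {0..2 * (x - 1)} (0 + (x - 1) * t) *\<^sub>R g (0 + (x - 1) * t))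
          = (\<lambda>t. indicator {0..2} t *\<^sub>R g (t * (x - 1)))"
      proof
        fix t :: real
        have "(x - 1) * t \<le> (x - 1) * 2 \<longleftrightarrow> t \<le> 2" "0 \<le> (x - 1) * t \<longleftrightarrow> 0 \<le> t"
          using x mult_le_cancel_left_pos[of "x - 1" t 2] mult_le_cancel_left_pos[of "x - 1" 0 t]
          by simp_all
        then have "0 + (x - 1) * t \<in> {0..2 * (x - 1)} \<longleftrightarrow> t \<in> {0..2}"
          by (simp only: atLeastAtMost_iff add_0 mult.commute[of 2])
        then have "indicator {0..2 * (x - 1)} (0 + (x - 1) * t) = (indicator {0..2} t :: real)"
          unfolding indicator_def by (simp only:)
        then show "indicator {0..2 * (x - 1)} (0 + (x - 1) * t) *\<^sub>R g (0 + (x - 1) * t)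
            = indicator {0..2} t *\<^sub>R g (t * (x - 1))"
          by (simp only: add_0 mult.commute)
      qed
      also have "(LBINT t. indicator {0..2} t *\<^sub>R g (t * (x - 1))) = (LINT t|L. g (t * (x - 1)))"
        unfolding L_def by (rule integral_restrict_space[symmetric]) simp
      finally show ?thesis using x by simp
    qed
    have "pairing g \<nu> = (LINT p|(R \<Otimes>\<^sub>M L). g (snd p * (fst p - 1)))"
      unfolding pairing_def \<nu>_def by (rule integral_distr[OF m bg])
    also have "\<dots> = (LINT x|R. LINT t|L. g (t * (x - 1)))"
      using RL.integral_fst'[OF int] by simp
    also have "\<dots> = (LINT x|R. 1 / (x - 1) * (LBINT y:{0..2 * (x - 1)}. g y))"
      by (rule Bochner_Integration.integral_cong) (auto simp: spR inner)
    also have "\<dots> = (LINT x:{1<..2}|\<mu>. 1 / (x - 1) * (LBINT y:{0..2 * (x - 1)}. g y))"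
      unfolding R_def set_lebesgue_integral_def by (rule integral_restrict_space[OF in1])
    finally show ?thesis .
  qed
  ultimately show "\<exists>\<nu>. \<nu> \<in> Mplus \<and> (\<forall>g. continuous_on {0..2} g \<longrightarrow>
     pairing g \<nu> = (LINT x:{1<..2}|\<mu>. 1 / (x - 1) * (LBINT y:{0..2 * (x - 1)}. g y)))" by blast
qed (auto intro: Mplus_eqI)

lemma op_U_well_defined:
  assumes "\<mu> \<in> Mplus"
  shows "op_U \<mu> \<in> Mplus"
    and "continuous_on {0..2} g \<Longrightarrow> pairing g (op_U \<mu>) = (LINT x:{0..1}|\<mu>. g (2 * x))"
  using theI'[OF op_U_ex1[OF assms]] unfolding op_U_def by blast+

lemma op_V_well_defined:
  assumes "\<mu> \<in> Mplus"
  shows "op_V \<mu> \<in> Mplus"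
    and "continuous_on {0..2} g \<Longrightarrow> pairing g (op_V \<mu>) =
      (LINT x:{1<..2}|\<mu>. 1 / (x - 1) * (LBINT y:{0..2 * (x - 1)}. g y))"
  using theI'[OF op_V_ex1[OF assms]] unfolding op_V_def by blast+

lemma emeasure_op_T:
  assumes M: "\<mu> \<in> Mplus" and A: "A \<in> sets (restrict_space borel {0..2})"
  shows "emeasure (op_T \<mu>) A = emeasure (op_U \<mu>) A + emeasure (op_V \<mu>) A"
proof -
  have sU: "sets (op_U \<mu>) = sets (restrict_space borel {0..2})"
    and sV: "sets (op_V \<mu>) = sets (restrict_space borel {0..2})"
    using op_U_well_defined(1)[OF M] op_V_well_defined(1)[OF M] by (auto simp: Mplus_def)
  show ?thesis unfolding op_T_def
  proof (rule emeasure_measure_of_sigma)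
    show "sigma_algebra {0..2::real} (sets (restrict_space borel {0..2}))"
      using sets.sigma_algebra_axioms[of "restrict_space borel {0..2::real}"]
      by (simp add: space_restrict_space)
    show "positive (sets (restrict_space borel {0..2}))
        (\<lambda>A. emeasure (op_U \<mu>) A + emeasure (op_V \<mu>) A)"
      by (simp add: positive_def)
    show "countably_additive (sets (restrict_space borel {0..2}))
        (\<lambda>A. emeasure (op_U \<mu>) A + emeasure (op_V \<mu>) A)"
    proof (rule countably_additiveI)
      fix F :: "nat \<Rightarrow> real set"
      assume F: "range F \<subseteq> sets (restrict_space borel {0..2})" "disjoint_family F"
      show "(\<Sum>i. emeasure (op_U \<mu>) (F i) + emeasure (op_V \<mu>) (F i))
          = emeasure (op_U \<mu>) (\<Union>(range F)) + emeasure (op_V \<mu>) (\<Union>(range F))"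
        by (subst suminf_add[symmetric]) (use F in \<open>auto simp: suminf_emeasure sU sV\<close>)
    qed
  qed (rule A)
qed

lemma op_T_Mplus:
  assumes M: "\<mu> \<in> Mplus"
  shows "op_T \<mu> \<in> Mplus"
proof -
  have sub: "sets (restrict_space borel {0..2::real}) \<subseteq> Pow {0..2}"
    by (auto simp: sets_restrict_space)
  have top: "{0..2::real} \<in> sets (restrict_space borel {0..2})"
    by (auto simp: sets_restrict_space)
  have sp: "space (op_T \<mu>) = {0..2}" unfolding op_T_def by (rule space_measure_of[OF sub])
  have s: "sets (op_T \<mu>) = sets (restrict_space borel {0..2})"
    unfolding op_T_def
    using sets.sigma_sets_eq[of "restrict_space borel {0..2::real}"]
    by (simp add: sets_measure_of[OF sub] space_restrict_space)
  have "finite_measure (op_U \<mu>)" "finite_measure (op_V \<mu>)"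
    using op_U_well_defined(1)[OF M] op_V_well_defined(1)[OF M] by (auto simp: Mplus_def)
  then have "finite_measure (op_T \<mu>)"
    by (intro finite_measureI)
      (simp add: sp emeasure_op_T[OF M top] finite_measure.emeasure_finite)
  then show ?thesis using sp s by (simp add: Mplus_def)
qed

end

theory Submission
  imports Defs
begin

text \<open>
  Write \<open>S = (0,2]\<close>, let \<open>T\<close> be the operator on densities, \<open>\<lambda> = 1 + C\<close> and
  \<open>w(x) = 1 + ln 2 - ln x\<close>. Since \<open>\<integral>\<^bsub>1+x/2\<^esub>\<^bsup>2\<^esup> dy/(y-1) = ln 2 - ln x\<close>, the eigenfunction \<open>f*\<close> lies
  between two positive multiples of \<open>w\<close>, so \<open>0 \<le> f \<le> M f*\<close>. For continuous \<open>h \<ge> 0\<close> the third iterate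
  satisfies the Doeblin condition \<open>T\<^sup>3 h \<ge> (w/4) \<integral>\<^bsub>3/2\<^esub>\<^bsup>2\<^esup> h\<close>: from \<open>(0,1]\<close> the kernel of \<open>T\<close>
  reaches all of \<open>[3/2,2]\<close>, and halving brings every point into \<open>(0,1]\<close>.
  Applied to \<open>T\<^sup>n f - m \<lambda>\<^sup>n f*\<close> and \<open>M \<lambda>\<^sup>n f* - T\<^sup>n f\<close>, it shows that the oscillation of
  \<open>T\<^sup>n f / (\<lambda>\<^sup>n f*)\<close> shrinks geometrically. So this quotient tends uniformly to a constant, which is
  positive because iterates of a nonzero density eventually spread over \<open>[3/2,2]\<close>.
\<close>

subsection \<open>The operator on densities\<close>

definition dens_op :: "(real \<Rightarrow> real) \<Rightarrow> real \<Rightarrow> real" where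
  "dens_op f x = f (x / 2) / 2 + (LBINT y:{1 + x / 2..2}. f y / (y - 1))"

text \<open>For \<open>x > 0\<close> the interval starts strictly to the right of the pole at
  \<open>y = 1\<close>.\<close>

lemma continuous_on_kernel:
  fixes f :: "real \<Rightarrow> real"
  assumes "continuous_on {0<..2} f" "0 < x"
  shows "continuous_on {1 + x / 2..2} (\<lambda>y. f y / (y - 1))"
  by (intro continuous_intros continuous_on_subset[OF assms(1)]) (use assms in auto)

lemma kernel_integrable:
  fixes f :: "real \<Rightarrow> real"
  assumes "continuous_on {0<..2} f" "0 < x"
  shows "set_integrable lborel {1 + x / 2..2} (\<lambda>y. f y / (y - 1))"
  by (rule borel_integrable_atLeastAtMost'[OF continuous_on_kernel[OF assms]])

text \<open>An integral depends continuously on its lower limit. The pole allows this only on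
  \<open>{a..2}\<close> with \<open>a > 0\<close>; continuity is local, so these intervals
  suffice.\<close>

lemma continuous_on_kernel_integral:
  fixes f :: "real \<Rightarrow> real"
  assumes f: "continuous_on {0<..2} f"
  shows "continuous_on {0<..2} (\<lambda>x. LBINT y:{1 + x / 2..2}. f y / (y - 1))"
proof -
  have loc: "continuous_on {a..2} (\<lambda>x. LBINT y:{1 + x / 2..2}. f y / (y - 1))" if a: "0 < a" for a
  proof -
    have "continuous_on {1 + a / 2..2} (\<lambda>z. integral {z..2} (\<lambda>y. f y / (y - 1)))"
      by (rule indefinite_integral_continuous_1'[OF
            integrable_continuous_real[OF continuous_on_kernel[OF f a]]])
    then have "continuous_on {a..2} (\<lambda>x. integral {1 + x / 2..2} (\<lambda>y. f y / (y - 1)))"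
      by (rule continuous_on_compose2) (auto intro!: continuous_intros)
    then show ?thesis
      by (subst continuous_on_cong[OF refl set_borel_integral_eq_integral(2)[OF kernel_integrable[OF f]]])
        (use a in auto)
  qed
  show ?thesis
    unfolding continuous_on_eq_continuous_within
  proof
    fix x :: real assume x: "x \<in> {0<..2}"
    have "at x within {0<..2} = at x within {x / 2..2}"
      by (rule at_within_nhd[of x "{x / 2<..}"]) (use x in auto)
    with loc[of "x / 2"] x
    show "continuous (at x within {0<..2}) (\<lambda>x. LBINT y:{1 + x / 2..2}. f y / (y - 1))"
      by (auto simp: continuous_on_eq_continuous_within continuous_within)
  qed
qed

lemma continuous_on_dens_op:
  assumes "continuous_on {0<..2} f"
  shows "continuous_on {0<..2} (dens_op f)"
  unfolding dens_op_def
  by (intro continuous_intros continuous_on_kernel_integral assms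
      continuous_on_compose2[OF assms]) auto

lemma continuous_on_dens_op_pow:
  assumes "continuous_on {0<..2} f"
  shows "continuous_on {0<..2} ((dens_op ^^ n) f)"
  using assms by (induction n) (auto intro: continuous_on_dens_op)

lemma dens_op_cong:
  assumes "\<And>x. x \<in> {0<..2} \<Longrightarrow> f x = g x" "x \<in> {0<..2}"
  shows "dens_op f x = dens_op g x"
  unfolding dens_op_def using assms
  by (auto intro!: arg_cong2[where f = "(+)"] set_lebesgue_integral_cong)

text \<open>Linearity in the shape used later: gaps such as \<open>F - m * fs\<close> and
  \<open>M * fs - F\<close>, and plain scaling as the case \<open>b = 0\<close>.\<close>

lemma dens_op_diff:
  assumes f: "continuous_on {0<..2} f" and g: "continuous_on {0<..2} g" and x: "x \<in> {0<..2}"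
  shows "dens_op (\<lambda>x. a * f x - b * g x) x = a * dens_op f x - b * dens_op g x"
proof -
  have [simp]: "0 < x" using x by simp
  note i = kernel_integrable[OF f \<open>0 < x\<close>] kernel_integrable[OF g \<open>0 < x\<close>]
  have "(LBINT y:{1 + x / 2..2}. a * (f y / (y - 1)) - b * (g y / (y - 1)))
    = a * (LBINT y:{1 + x / 2..2}. f y / (y - 1)) - b * (LBINT y:{1 + x / 2..2}. g y / (y - 1))"
    by (subst set_integral_diff(2))
      (auto simp del: times_divide_eq_right intro!: set_integrable_mult_right i)
  then show ?thesis by (simp add: dens_op_def diff_divide_distrib algebra_simps)
qed

lemma dens_op_pow_diff:
  assumes f: "continuous_on {0<..2} f" and g: "continuous_on {0<..2} g" and "x \<in> {0<..2}"
  shows "(dens_op ^^ n) (\<lambda>x. a * f x - b * g x) x = a * (dens_op ^^ n) f x - b * (dens_op ^^ n) g x"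
  using assms(3)
proof (induction n arbitrary: x)
  case (Suc n)
  have "(dens_op ^^ Suc n) (\<lambda>x. a * f x - b * g x) x
      = dens_op (\<lambda>x. a * (dens_op ^^ n) f x - b * (dens_op ^^ n) g x) x"
    by simp (rule dens_op_cong[OF Suc.IH Suc.prems])
  then show ?case
    using dens_op_diff[OF continuous_on_dens_op_pow[OF f] continuous_on_dens_op_pow[OF g] Suc.prems]
    by simp
qed simp

section \<open>Positivity and the three-step Doeblin bound\<close>

lemma kernel_integral_nonneg:
  fixes f :: "real \<Rightarrow> real"
  assumes "\<And>x. x \<in> {0<..2} \<Longrightarrow> 0 \<le> f x" "0 < x"
  shows "0 \<le> (LBINT y:{1 + x / 2..2}. f y / (y - 1))"
  unfolding set_lebesgue_integral_def using assms
  by (intro integral_nonneg_AE AE_I2) (auto simp: indicator_def)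

lemma dens_op_ge_half:
  assumes "\<And>x. x \<in> {0<..2} \<Longrightarrow> 0 \<le> f x" "x \<in> {0<..2}"
  shows "f (x / 2) / 2 \<le> dens_op f x"
  using kernel_integral_nonneg[of f x] assms by (simp add: dens_op_def)

lemma dens_op_nonneg:
  assumes "\<And>x. x \<in> {0<..2} \<Longrightarrow> 0 \<le> f x" "x \<in> {0<..2}"
  shows "0 \<le> dens_op f x"
proof -
  have "0 \<le> f (x / 2)" using assms(2) by (intro assms(1)) auto
  then show ?thesis using dens_op_ge_half[of f, OF assms] by simp
qed

lemma dens_op_pow_nonneg:
  assumes "\<And>x. x \<in> {0<..2} \<Longrightarrow> 0 \<le> f x" "x \<in> {0<..2}"
  shows "0 \<le> (dens_op ^^ n) f x"
  using assms(2) by (induction n arbitrary: x) (auto intro!: assms(1) dens_op_nonneg)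

text \<open>The antiderivative is \<open>ln (y - 1)\<close>. This is the source of the logarithmic
  weight in all comparisons below.\<close>

lemma kernel_integral_one:
  fixes x :: real
  assumes x: "x \<in> {0<..2}"
  shows "(LBINT y:{1 + x / 2..2}. 1 / (y - 1)) = ln 2 - ln x"
proof -
  have "((\<lambda>y. 1 / (y - 1)) has_integral (ln (2 - 1) - ln (1 + x / 2 - 1))) {1 + x / 2..2}"
    using x by (intro fundamental_theorem_of_calculus)
      (auto intro!: derivative_eq_intros simp flip: has_real_derivative_iff_has_vector_derivative)
  moreover have "set_integrable lborel {1 + x / 2..2} (\<lambda>y. 1 / (y - 1))"
    using kernel_integrable[of "\<lambda>_. 1" x] x by auto
  ultimately show ?thesis
    using x by (simp add: set_borel_integral_eq_integral(2) integral_unique ln_div)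
qed

lemma kernel_integral_ge:
  fixes f :: "real \<Rightarrow> real"
  assumes f: "continuous_on {0<..2} f" and x: "x \<in> {0<..2}"
    and c: "\<And>y. y \<in> {1..2} \<Longrightarrow> c \<le> f y"
  shows "c * (ln 2 - ln x) \<le> (LBINT y:{1 + x / 2..2}. f y / (y - 1))"
proof -
  have "set_integrable lborel {1 + x / 2..2} (\<lambda>y. c * (1 / (y - 1)))"
    using kernel_integrable[of "\<lambda>_. c" x] x by auto
  then have "(LBINT y:{1 + x / 2..2}. c * (1 / (y - 1))) \<le> (LBINT y:{1 + x / 2..2}. f y / (y - 1))"
    using x by (intro set_integral_mono kernel_integrable[OF f])
      (auto intro!: divide_right_mono c)
  then show ?thesis using kernel_integral_one[OF x] by (simp del: times_divide_eq_right)
qed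

text \<open>Each application of the operator improves the bound: first a constant on (0,1], then a
  constant on all of (0,2], finally a multiple of the logarithmic weight.\<close>

lemma dens_op_cube_ge:
  assumes f: "continuous_on {0<..2} f" and nn: "\<And>x. x \<in> {0<..2} \<Longrightarrow> 0 \<le> f x"
    and x: "x \<in> {0<..2}"
  shows "(LBINT y:{3 / 2..2}. f y) / 4 * (1 + (ln 2 - ln x)) \<le> (dens_op ^^ 3) f x"
proof -
  define J where "J = (LBINT y:{3 / 2..2}. f y)"
  have fi: "set_integrable lborel {3 / 2..2} f"
    by (intro borel_integrable_atLeastAtMost' continuous_on_subset[OF f]) auto
  have 0: "0 \<le> J" unfolding J_def set_lebesgue_integral_def using nn
    by (intro integral_nonneg_AE AE_I2) (auto simp: indicator_def)
  \<comment> \<open>For \<open>z \<le> 1\<close> the range of integration contains [3/2,2], and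
    there \<open>1 / (y - 1) \<ge> 1\<close>.\<close>
  have 1: "J \<le> dens_op f z" if z: "z \<in> {0<..1}" for z
  proof -
    have ki: "set_integrable lborel {1 + z / 2..2} (\<lambda>y. f y / (y - 1))"
      using kernel_integrable[OF f] z by simp
    have "J \<le> (LBINT y:{3 / 2..2}. f y / (y - 1))"
      unfolding J_def
    proof (rule set_integral_mono[OF fi set_integrable_subset[OF ki]])
      fix y :: real assume y: "y \<in> {3 / 2..2}"
      show "f y \<le> f y / (y - 1)"
        using y nn[of y] mult_right_mono[of y 2 "f y"] by (simp add: field_simps)
    qed (use z in auto)
    also have "\<dots> \<le> (LBINT y:{1 + z / 2..2}. f y / (y - 1))"
      using ki set_integrable_subset[OF ki, of "{3 / 2..2}"] z nn
      unfolding set_lebesgue_integral_def set_integrable_def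
      by (intro integral_mono) (auto simp: indicator_def)
    also have "\<dots> \<le> dens_op f z"
      using nn[of "z / 2"] z by (simp add: dens_op_def)
    finally show ?thesis .
  qed
  \<comment> \<open>The halving term carries the bound from \<open>z / 2\<close> in (0,1] to every
    \<open>z\<close> in (0,2], at the cost of a factor 1/2.\<close>
  have 2: "J / 2 \<le> dens_op (dens_op f) z" if z: "z \<in> {0<..2}" for z
    using 1[of "z / 2"] dens_op_ge_half[of "dens_op f" z] dens_op_nonneg[of f, OF nn] z by auto
  have "(J / 2) * (ln 2 - ln x) \<le> (LBINT y:{1 + x / 2..2}. dens_op (dens_op f) y / (y - 1))"
    by (intro kernel_integral_ge continuous_on_dens_op f x 2) auto
  moreover have "J / 2 / 2 \<le> dens_op (dens_op f) (x / 2) / 2"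
    using 2[of "x / 2"] x by auto
  ultimately have "J / 4 + (J / 2) * (ln 2 - ln x) \<le> (dens_op ^^ 3) f x"
    by (simp add: numeral_3_eq_3 dens_op_def[of "dens_op (dens_op f)"])
  \<comment> \<open>The third application yields the constant \<open>J / 4\<close> by halving and
    the coefficient \<open>J / 2\<close> of the logarithm by integration; the latter is lowered so
    that one common factor remains.\<close>
  moreover have "J / 4 * (ln 2 - ln x) \<le> (J / 2) * (ln 2 - ln x)"
    using 0 x by (intro mult_right_mono) auto
  ultimately show ?thesis
    unfolding J_def[symmetric] by (simp add: distrib_left)
qed

section \<open>Spreading of zeros\<close>

lemma set_integral_eq_0_continuous:
  fixes f :: "real \<Rightarrow> real"
  assumes f: "continuous_on {a..b} f" and nn: "\<And>x. x \<in> {a..b} \<Longrightarrow> 0 \<le> f x"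
    and z: "(LBINT x:{a..b}. f x) = 0" and x: "x \<in> {a..b}" and ab: "a < b"
  shows "f x = 0"
proof -
  have fi: "set_integrable lborel {a..b} f"
    by (rule borel_integrable_atLeastAtMost'[OF f])
  then have "(f has_integral 0) (cbox a b)"
    using z set_borel_integral_eq_integral[OF fi] by (metis has_integral_integral cbox_interval)
  then show ?thesis
    by (rule has_integral_0_cbox_imp_0[rotated 2]) (use assms in \<open>auto simp: interior_cbox\<close>)
qed

text \<open>Both summands of \<open>dens_op f x\<close> are nonnegative, so both vanish. The
  condition \<open>x < 2\<close> keeps the interval nondegenerate, as continuity needs to reach its
  endpoints.\<close>

lemma dens_op_eq_0D:
  assumes f: "continuous_on {0<..2} f" and nn: "\<And>x. x \<in> {0<..2} \<Longrightarrow> 0 \<le> f x"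
    and x: "x \<in> {0<..2}" and z: "dens_op f x = 0"
  shows "f (x / 2) = 0" "x < 2 \<Longrightarrow> y \<in> {1 + x / 2..2} \<Longrightarrow> f y = 0"
proof -
  have a: "0 \<le> f (x / 2)" using nn x by auto
  have b: "0 \<le> (LBINT y:{1 + x / 2..2}. f y / (y - 1))"
    by (rule kernel_integral_nonneg) (use nn x in auto)
  show "f (x / 2) = 0" using a b z by (simp add: dens_op_def)
  have c: "(LBINT y:{1 + x / 2..2}. f y / (y - 1)) = 0" using a b z by (simp add: dens_op_def)
  show "f y = 0" if "x < 2" "y \<in> {1 + x / 2..2}"
  proof -
    have "f y / (y - 1) = 0"
      by (rule set_integral_eq_0_continuous[OF continuous_on_kernel[OF f] _ c])
        (use x that nn in auto)
    then show ?thesis using x that by auto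
  qed
qed

text \<open>Irreducibility. A common zero of all iterates at \<open>x\<close> moves by halving to
  points near 0, from there through the integral to all of (1,2], and again by halving down to every
  point. Each move consumes one iterate, which is why all \<open>n\<close> are assumed.\<close>

lemma dens_op_pow_eq_0_imp_0:
  assumes f: "continuous_on {0<..2} f" and nn: "\<And>x. x \<in> {0<..2} \<Longrightarrow> 0 \<le> f x"
    and x: "x \<in> {0<..2}" and z: "\<And>n. (dens_op ^^ n) f x = 0" and y: "y \<in> {0<..2}"
  shows "f y = 0"
proof -
  note c = continuous_on_dens_op_pow[OF f] and p = dens_op_pow_nonneg[of f, OF nn]
  have pw: "u / 2 ^ j \<in> {0<..2}" if "u \<in> {0<..2}" for u :: real and j
    using that by (auto simp: divide_le_eq intro: order_trans[of _ 2] mult_le_cancel_left1[THEN iffD2])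
  have halve: "(dens_op ^^ n) f (u / 2 ^ j) = 0"
    if "u \<in> {0<..2}" "\<And>n. (dens_op ^^ n) f u = 0" for u n j
  proof (induction j arbitrary: n)
    case (Suc j)
    have "dens_op ((dens_op ^^ n) f) (u / 2 ^ j) = 0" using Suc[of "Suc n"] by simp
    from dens_op_eq_0D(1)[OF c p pw[OF that(1)] this] show ?case by (simp add: mult.commute)
  qed (use that in simp)
  \<comment> \<open>Once \<open>x / 2 ^ j < u - 1\<close>, the point \<open>u\<close> lies in the
    range of integration belonging to \<open>x / 2 ^ j\<close>.\<close>
  have upper: "(dens_op ^^ n) f u = 0" if u: "u \<in> {1<..2}" for u n
  proof -
    obtain j where "x / (u - 1) < 2 ^ j" using real_arch_pow[of 2] by auto
    then have "x / 2 ^ j < u - 1" using u by (simp add: field_simps)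
    moreover have "0 < x / 2 ^ j" using x by simp
    ultimately have "u \<in> {1 + x / 2 ^ j / 2..2}" "x / 2 ^ j < 2" using u by auto
    moreover have "dens_op ((dens_op ^^ n) f) (x / 2 ^ j) = 0" using halve[OF x z, of "Suc n"] by simp
    ultimately show ?thesis using dens_op_eq_0D(2)[OF c p pw[OF x]] by blast
  qed
  \<comment> \<open>For \<open>u \<le> 1\<close> the point \<open>2 * u\<close> falls under the
    induction hypothesis, and a zero of the next iterate at \<open>2 * u\<close> forces one at
    \<open>u\<close>.\<close>
  have "(dens_op ^^ n) f u = 0" if "u \<in> {1 / 2 ^ j<..2}" for u n j
    using that
  proof (induction j arbitrary: n u)
    case (Suc j)
    show ?case
    proof (cases "u > 1")
      case False
      have d: "2 * u \<in> {0<..2}" "2 * u \<in> {1 / 2 ^ j<..2}"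
        using Suc.prems False less_trans[of 0 "1 / 2 ^ Suc j" u] by (auto simp: field_simps)
      have "dens_op ((dens_op ^^ n) f) (2 * u) = 0" using Suc.IH[OF d(2), of "Suc n"] by simp
      from dens_op_eq_0D(1)[OF c p d(1) this] show ?thesis by simp
    qed (use upper Suc.prems in auto)
  qed (use upper in auto)
  moreover obtain j where "1 / y < 2 ^ j" using real_arch_pow[of 2] by auto
  ultimately show ?thesis
    using y by (metis (no_types, lifting) funpow_0 greaterThanAtMost_iff divide_less_eq
        mult.commute zero_less_numeral zero_less_power)
qed

subsection \<open>Contraction towards a positive eigenfunction\<close>

text \<open>\<open>K\<close> compares \<open>fs\<close> from above with the logarithmic weight; the
  matching lower comparison is derived in \<open>lower\<close>. The eigenvalue \<open>lam\<close>
  will be instantiated with 1 + C.\<close>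

locale dens_op_eigenfunction =
  fixes fs :: "real \<Rightarrow> real" and lam K :: real
  assumes cont: "continuous_on {0<..2} fs"
    and nonneg: "\<And>x. x \<in> {0<..2} \<Longrightarrow> 0 \<le> fs x"
    and integrable: "set_integrable lborel {0<..2} fs"
    and integral: "(LBINT x:{0<..2}. fs x) = 1"
    and eigen: "\<And>x. x \<in> {0<..2} \<Longrightarrow> dens_op fs x = lam * fs x"
    and lam: "0 < lam"
    and K: "0 < K" "\<And>x. x \<in> {0<..2} \<Longrightarrow> fs x \<le> K * (1 + (ln 2 - ln x))"
begin

lemma eigen_pow: "x \<in> {0<..2} \<Longrightarrow> (dens_op ^^ n) fs x = lam ^ n * fs x"
proof (induction n arbitrary: x)
  case (Suc n)
  \<comment> \<open>The vacuous subtraction brings the scaled function into the shape of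
    \<open>dens_op_diff\<close>.\<close>
  have "dens_op ((dens_op ^^ n) fs) x = dens_op (\<lambda>x. lam ^ n * fs x - 0 * fs x) x"
    by (rule dens_op_cong[OF _ Suc.prems]) (simp add: Suc.IH)
  also have "\<dots> = lam ^ n * dens_op fs x"
    using dens_op_diff[OF cont cont Suc.prems, of "lam ^ n" 0] by simp
  finally show ?case using Suc.prems by (simp add: eigen)
qed simp

text \<open>By the eigenvalue equation a zero of \<open>fs\<close> is a zero of all its iterates, so
  irreducibility would make \<open>fs\<close> vanish identically, against mass 1.\<close>

lemma pos:
  assumes "x \<in> {0<..2}"
  shows "0 < fs x"
proof (rule ccontr)
  assume "\<not> 0 < fs x"
  then have z: "fs x = 0" using nonneg[OF assms] by simp
  have "fs y = 0" if "y \<in> {0<..2}" for y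
    by (rule dens_op_pow_eq_0_imp_0[OF cont nonneg assms _ that]) (simp_all add: eigen_pow[OF assms] z)
  then have "(LBINT x:{0<..2}. fs x) = (LBINT x:{0<..2::real}. 0)"
    by (intro set_lebesgue_integral_cong) auto
  then show False using integral by simp
qed

text \<open>On [1/2,2] the weight is bounded and \<open>fs\<close> has a positive minimum. Below 1/2
  the integral in the eigenvalue equation forces logarithmic growth, since \<open>fs\<close> is at
  least that minimum on [1,2].\<close>

lemma lower:
  obtains c where "0 < c" "\<And>x. x \<in> {0<..2} \<Longrightarrow> c * (1 + (ln 2 - ln x)) \<le> fs x"
proof -
  have "\<exists>x\<in>{1 / 2..2}. \<forall>y\<in>{1 / 2..2}. fs x \<le> fs y"
    by (rule continuous_attains_inf) (auto intro: continuous_on_subset[OF cont])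
  then obtain u where u: "u \<in> {1 / 2..2}" "\<And>y. y \<in> {1 / 2..2} \<Longrightarrow> fs u \<le> fs y" by blast
  have m: "0 < fs u" using u by (intro pos) auto
  \<comment> \<open>The weight is at most 3 on [1/2,2], and at most \<open>2 * (ln 2 - ln x)\<close>
    below 1/2.\<close>
  define c where "c = min (fs u / 3) (fs u / (2 * lam))"
  show ?thesis
  proof
    show "0 < c" using m lam by (simp add: c_def)
    fix x :: real assume x: "x \<in> {0<..2}"
    have w: "0 \<le> ln 2 - ln x" using x by simp
    show "c * (1 + (ln 2 - ln x)) \<le> fs x"
    proof (cases "x \<ge> 1 / 2")
      case True
      have "ln (1 / 2) \<le> ln x" using True by (subst ln_le_cancel_iff) auto
      then have "ln 2 - ln x \<le> 2"
        using ln_le_minus_one[of 2] by (simp add: ln_div)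
      then have "c * (1 + (ln 2 - ln x)) \<le> (fs u / 3) * 3"
        using m w by (intro mult_mono) (auto simp: c_def)
      also have "\<dots> \<le> fs x" using u(2)[of x] True x by simp
      finally show ?thesis .
    next
      case False
      have "ln x \<le> ln (1 / 2)" using False x by (subst ln_le_cancel_iff) auto
      moreover have "1 / 2 \<le> ln (2::real)" using ln_ge_iff[of 2 "1/2"] exp_half_le2 by simp
      ultimately have w1: "1 \<le> ln 2 - ln x" by (simp add: ln_div)
      have "fs u * (ln 2 - ln x) \<le> (LBINT y:{1 + x / 2..2}. fs y / (y - 1))"
        by (intro kernel_integral_ge cont x u) auto
      also have "\<dots> \<le> lam * fs x"
        using eigen[OF x] nonneg[of "x / 2"] x by (simp add: dens_op_def)
      finally have "fs u / lam * (ln 2 - ln x) \<le> fs x" using lam by (simp add: field_simps)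
      moreover have "fs u / (2 * lam) * (2 * (ln 2 - ln x)) = fs u / lam * (ln 2 - ln x)"
        using lam by (simp add: field_simps)
      moreover have "c * (1 + (ln 2 - ln x)) \<le> fs u / (2 * lam) * (2 * (ln 2 - ln x))"
        using m w1 lam by (intro mult_mono) (auto simp: c_def)
      ultimately show ?thesis by linarith
    qed
  qed
qed

text \<open>The Doeblin bound with the weight replaced by \<open>fs / K\<close>, so that the
  minorant is the eigenfunction itself.\<close>

lemma cube_ge:
  assumes F: "continuous_on {0<..2} F" "\<And>x. x \<in> {0<..2} \<Longrightarrow> 0 \<le> F x" and x: "x \<in> {0<..2}"
  shows "(LBINT y:{3 / 2..2}. F y) / (4 * K) * fs x \<le> (dens_op ^^ 3) F x"
proof -
  have "0 \<le> (LBINT y:{3 / 2..2}. F y)"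
    unfolding set_lebesgue_integral_def using F(2)
    by (intro integral_nonneg_AE AE_I2) (auto simp: indicator_def)
  then have "(LBINT y:{3 / 2..2}. F y) / (4 * K) * fs x
      \<le> (LBINT y:{3 / 2..2}. F y) / (4 * K) * (K * (1 + (ln 2 - ln x)))"
    using K x by (intro mult_left_mono) auto
  also have "\<dots> = (LBINT y:{3 / 2..2}. F y) / 4 * (1 + (ln 2 - ln x))"
    using K(1) by (simp add: field_simps)
  also have "\<dots> \<le> (dens_op ^^ 3) F x"
    by (rule dens_op_cube_ge[OF F x])
  finally show ?thesis .
qed

text \<open>\<open>cube_ge\<close> applied to the nonnegative gaps \<open>F - m * fs\<close> and
  \<open>M * fs - F\<close> raises the lower bound and lowers the upper one. Since \<open>I\<close>
  is linear, the two gains add up to \<open>e * I fs * (M - m)\<close>, a fraction of the gap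
  independent of \<open>F\<close>.\<close>

lemma contraction:
  obtains q where "0 \<le> q" "q < 1"
    "\<And>F m M. continuous_on {0<..2} F \<Longrightarrow> (\<forall>x\<in>{0<..2}. m * fs x \<le> F x \<and> F x \<le> M * fs x) \<Longrightarrow>
      \<exists>m' M'. m \<le> m' \<and> M' \<le> M \<and> M' - m' \<le> q * (M - m) \<and>
        (\<forall>x\<in>{0<..2}. m' * lam ^ 3 * fs x \<le> (dens_op ^^ 3) F x \<and>
          (dens_op ^^ 3) F x \<le> M' * lam ^ 3 * fs x)"
proof -
  define I where "I F = (LBINT y:{3 / 2..2}. F y)" for F :: "real \<Rightarrow> real"
  \<comment> \<open>The constant of \<open>cube_ge\<close>, divided by the growth of
    \<open>fs\<close> over three steps.\<close>
  define e where "e = 1 / (4 * K * lam ^ 3)"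
  have e: "0 < e" using K lam by (simp add: e_def)
  have si: "set_integrable lborel {3 / 2..2} F" if "continuous_on {0<..2} F" for F :: "real \<Rightarrow> real"
    by (intro borel_integrable_atLeastAtMost' continuous_on_subset[OF that]) auto
  have I0: "0 \<le> I F" if "\<And>x. x \<in> {0<..2} \<Longrightarrow> 0 \<le> F x" for F
    unfolding I_def set_lebesgue_integral_def using that
    by (intro integral_nonneg_AE AE_I2) (auto simp: indicator_def)
  have Id: "I (\<lambda>x. a * F x - b * G x) = a * I F - b * I G"
    if "continuous_on {0<..2} F" "continuous_on {0<..2} G" for F G a b
    unfolding I_def using si[OF that(1)] si[OF that(2)] by (subst set_integral_diff(2)) auto
  have Ifs: "0 < I fs"
  proof (rule ccontr)
    assume "\<not> 0 < I fs"
    then have "I fs = 0" using I0[of fs] nonneg by simp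
    then have "fs 2 = 0"
      unfolding I_def using nonneg
      by (intro set_integral_eq_0_continuous[where a = "3 / 2" and b = 2 and f = fs])
        (auto intro: continuous_on_subset[OF cont])
    then show False using pos[of 2] by simp
  qed
  have cube: "e * I (\<lambda>x. a * F x - b * G x) * lam ^ 3 * fs x
        \<le> a * (dens_op ^^ 3) F x - b * (dens_op ^^ 3) G x"
    if F: "continuous_on {0<..2} F" and G: "continuous_on {0<..2} G"
      and nn: "\<And>x. x \<in> {0<..2} \<Longrightarrow> 0 \<le> a * F x - b * G x" and x: "x \<in> {0<..2}" for F G a b x
  proof -
    have "I (\<lambda>x. a * F x - b * G x) / (4 * K) * fs x \<le> (dens_op ^^ 3) (\<lambda>x. a * F x - b * G x) x"
      unfolding I_def by (intro cube_ge nn x continuous_intros F G)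
    then show ?thesis
      unfolding dens_op_pow_diff[OF F G x] using lam by (simp add: e_def)
  qed
  show ?thesis
  proof
    \<comment> \<open>The maximum keeps the factor nonnegative whatever the size of
      \<open>e * I fs\<close>.\<close>
    show "0 \<le> max 0 (1 - e * I fs)" by simp
    show "max 0 (1 - e * I fs) < 1" using e Ifs by simp
    fix F m M
    assume F: "continuous_on {0<..2} F"
      and b: "\<forall>x\<in>{0<..2}. m * fs x \<le> F x \<and> F x \<le> M * fs x"
    have mM: "m \<le> M" using b pos[of 2] by (metis greaterThanAtMost_iff mult_le_cancel_right_pos
          order.refl order_trans zero_less_numeral)
    define m' where "m' = m + e * I (\<lambda>x. 1 * F x - m * fs x)"
    define M' where "M' = M - e * I (\<lambda>x. M * fs x - 1 * F x)"
    have "m \<le> m'" "M' \<le> M"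
      using e b by (auto simp: m'_def M'_def intro!: mult_nonneg_nonneg I0)
    moreover have "M' - m' = (1 - e * I fs) * (M - m)"
      unfolding m'_def M'_def Id[OF F cont] Id[OF cont F] by (simp add: algebra_simps)
    then have "M' - m' \<le> max 0 (1 - e * I fs) * (M - m)"
      using mM by (simp add: mult_right_mono)
    moreover have "m' * lam ^ 3 * fs x \<le> (dens_op ^^ 3) F x" if x: "x \<in> {0<..2}" for x
      using cube[OF F cont _ x, of 1 m] b eigen_pow[OF x] by (simp add: m'_def algebra_simps)
    moreover have "(dens_op ^^ 3) F x \<le> M' * lam ^ 3 * fs x" if x: "x \<in> {0<..2}" for x
      using cube[OF cont F _ x, of M 1] b eigen_pow[OF x] by (simp add: M'_def algebra_simps)
    ultimately show "\<exists>m' M'. m \<le> m' \<and> M' \<le> M \<and> M' - m' \<le> max 0 (1 - e * I fs) * (M - m) \<and>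
        (\<forall>x\<in>{0<..2}. m' * lam ^ 3 * fs x \<le> (dens_op ^^ 3) F x \<and>
          (dens_op ^^ 3) F x \<le> M' * lam ^ 3 * fs x)"
      by blast
  qed
qed

section \<open>Two-sided bounds on the iterates\<close>

text \<open>States, without division, that the quotient of \<open>(dens_op ^^ n) f\<close> by
  \<open>lam ^ n * fs\<close> lies between \<open>m\<close> and \<open>M\<close>.\<close>

definition bracket :: "(real \<Rightarrow> real) \<Rightarrow> nat \<Rightarrow> real \<Rightarrow> real \<Rightarrow> bool" where
  "bracket f n m M \<longleftrightarrow> (\<forall>x\<in>{0<..2}. m * lam ^ n * fs x \<le> (dens_op ^^ n) f x \<and>
     (dens_op ^^ n) f x \<le> M * lam ^ n * fs x)"

text \<open>The operator preserves nonnegativity of both gaps, and the eigenvalue equation supplies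
  the extra factor \<open>lam\<close>.\<close>

lemma bracket_Suc:
  assumes f: "continuous_on {0<..2} f" and b: "bracket f n m M"
  shows "bracket f (Suc n) m M"
  unfolding bracket_def
proof (intro ballI)
  fix x :: real assume x: "x \<in> {0<..2}"
  let ?F = "(dens_op ^^ n) f"
  note F = continuous_on_dens_op_pow[OF f, of n]
  have "0 \<le> dens_op (\<lambda>x. 1 * ?F x - (m * lam ^ n) * fs x) x"
    using b by (intro dens_op_nonneg x) (auto simp: bracket_def)
  moreover have "0 \<le> dens_op (\<lambda>x. (M * lam ^ n) * fs x - 1 * ?F x) x"
    using b by (intro dens_op_nonneg x) (auto simp: bracket_def)
  ultimately show "m * lam ^ Suc n * fs x \<le> (dens_op ^^ Suc n) f x \<and>
      (dens_op ^^ Suc n) f x \<le> M * lam ^ Suc n * fs x"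
    unfolding dens_op_diff[OF F cont x] dens_op_diff[OF cont F x] eigen[OF x]
    by (simp add: algebra_simps)
qed

lemma bracket_mono:
  assumes "continuous_on {0<..2} f" "bracket f n m M" "n \<le> k"
  shows "bracket f k m M"
  using assms(3,2) by (induction rule: dec_induct) (auto intro: bracket_Suc assms(1))

text \<open>Contraction along the indices \<open>n + 3 * j\<close>; monotonicity of brackets covers
  the indices in between. The clause \<open>m \<le> m'\<close> later keeps the total masses away
  from 0.\<close>

lemma bracket_squeeze:
  assumes f: "continuous_on {0<..2} f" and b: "bracket f n m M" and e: "0 < e"
  obtains N where "\<And>k. N \<le> k \<Longrightarrow> \<exists>m' M'. m \<le> m' \<and> M' - m' \<le> e \<and> bracket f k m' M'"
proof -
  obtain q where q: "0 \<le> q" "q < 1" and ctr: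
    "\<And>F m M. continuous_on {0<..2} F \<Longrightarrow> (\<forall>x\<in>{0<..2}. m * fs x \<le> F x \<and> F x \<le> M * fs x) \<Longrightarrow>
      \<exists>m' M'. m \<le> m' \<and> M' \<le> M \<and> M' - m' \<le> q * (M - m) \<and>
        (\<forall>x\<in>{0<..2}. m' * lam ^ 3 * fs x \<le> (dens_op ^^ 3) F x \<and>
          (dens_op ^^ 3) F x \<le> M' * lam ^ 3 * fs x)"
    using contraction by metis
  \<comment> \<open>Contraction acts on the unnormalized iterate with bounds
    \<open>m * lam ^ n\<close> and \<open>M * lam ^ n\<close>; dividing by \<open>lam ^ n\<close>
    returns to bracket form.\<close>
  have step: "\<exists>m' M'. m \<le> m' \<and> M' - m' \<le> q * (M - m) \<and> bracket f (n + 3) m' M'"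
    if b: "bracket f n m M" for n m M
  proof -
    obtain a A where a: "m * lam ^ n \<le> a" "A \<le> M * lam ^ n" "A - a \<le> q * (M * lam ^ n - m * lam ^ n)"
      "\<forall>x\<in>{0<..2}. a * lam ^ 3 * fs x \<le> (dens_op ^^ 3) ((dens_op ^^ n) f) x \<and>
          (dens_op ^^ 3) ((dens_op ^^ n) f) x \<le> A * lam ^ 3 * fs x"
      using ctr[OF continuous_on_dens_op_pow[OF f] b[unfolded bracket_def]] by blast
    have p: "0 < lam ^ n" using lam by simp
    have "m \<le> a / lam ^ n" using a(1) p by (simp add: field_simps)
    moreover have "A / lam ^ n - a / lam ^ n \<le> q * (M - m)"
    proof -
      have "A / lam ^ n - a / lam ^ n = (A - a) / lam ^ n" by (simp add: diff_divide_distrib)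
      also have "\<dots> \<le> q * (M * lam ^ n - m * lam ^ n) / lam ^ n"
        using a(3) p by (simp add: divide_right_mono)
      also have "\<dots> = q * (M - m) * lam ^ n / lam ^ n" by (simp add: algebra_simps)
      also have "\<dots> = q * (M - m)" using lam by simp
      finally show ?thesis .
    qed
    moreover have "bracket f (n + 3) (a / lam ^ n) (A / lam ^ n)"
    proof -
      have "(dens_op ^^ (n + 3)) f = (dens_op ^^ 3) ((dens_op ^^ n) f)"
        by (simp add: funpow_add add.commute[of n])
      then show ?thesis
        using a(4) p lam by (simp add: bracket_def power_add)
    qed
    ultimately show ?thesis by blast
  qed
  have iter: "\<exists>m' M'. m \<le> m' \<and> M' - m' \<le> q ^ j * (M - m) \<and> bracket f (n + 3 * j) m' M'" for j
  proof (induction j)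
    case 0
    then show ?case using b by (intro exI[of _ m] exI[of _ M]) simp
  next
    case (Suc j)
    then obtain a A where a: "m \<le> a" "A - a \<le> q ^ j * (M - m)" "bracket f (n + 3 * j) a A" by blast
    from step[OF a(3)] obtain a' A' where a': "a \<le> a'" "A' - a' \<le> q * (A - a)"
      "bracket f (n + 3 * j + 3) a' A'" by blast
    have "q * (A - a) \<le> q ^ Suc j * (M - m)" using mult_left_mono[OF a(2) q(1)] by (simp add: mult.assoc)
    then show ?case using a a' by (intro exI[of _ a'] exI[of _ A']) (auto simp: algebra_simps)
  qed
  have "(\<lambda>j. q ^ j * (M - m)) \<longlonglongrightarrow> 0"
    using q by (auto intro!: tendsto_eq_intros LIMSEQ_power_zero)
  then have "\<forall>\<^sub>F j in sequentially. q ^ j * (M - m) < e" using e by (rule order_tendstoD)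
  then obtain j where j: "q ^ j * (M - m) < e" by (auto simp: eventually_sequentially)
  obtain m' M' where m': "m \<le> m'" "M' - m' \<le> q ^ j * (M - m)" "bracket f (n + 3 * j) m' M'"
    using iter by blast
  show ?thesis
  proof
    fix k assume "n + 3 * j \<le> k"
    then show "\<exists>m' M'. m \<le> m' \<and> M' - m' \<le> e \<and> bracket f k m' M'"
      using m' j bracket_mono[OF f m'(3)] by (intro exI[of _ m'] exI[of _ M']) auto
  qed
qed

text \<open>By irreducibility some iterate is nonzero at 2, hence has positive integral over
  [3/2,2]; three more steps lift it above a positive multiple of \<open>fs\<close>. The upper bound
  persists from the start.\<close>

lemma bracket_pos:
  assumes f: "continuous_on {0<..2} f" and nn: "\<And>x. x \<in> {0<..2} \<Longrightarrow> 0 \<le> f x"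
    and M: "\<And>x. x \<in> {0<..2} \<Longrightarrow> f x \<le> M * fs x" and nz: "y \<in> {0<..2}" "f y \<noteq> 0"
  obtains n m where "0 < m" "bracket f n m M"
proof -
  obtain n where n: "(dens_op ^^ n) f 2 \<noteq> 0"
    using dens_op_pow_eq_0_imp_0[OF f nn, of 2 y] nz by auto
  define J where "J = (LBINT y:{3 / 2..2}. (dens_op ^^ n) f y)"
  have "0 \<le> J"
    unfolding J_def set_lebesgue_integral_def using dens_op_pow_nonneg[of f, OF nn]
    by (intro integral_nonneg_AE AE_I2) (auto simp: indicator_def)
  moreover have "J \<noteq> 0"
  proof
    assume "J = 0"
    then have "(dens_op ^^ n) f 2 = 0"
      unfolding J_def
      by (intro set_integral_eq_0_continuous[where a = "3 / 2" and b = 2 and f = "(dens_op ^^ n) f"])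
        (auto intro: continuous_on_subset[OF continuous_on_dens_op_pow[OF f]]
          dens_op_pow_nonneg[of f, OF nn])
    then show False using n by simp
  qed
  ultimately have J: "0 < J" by simp
  have u: "bracket f (n + 3) 0 M"
    by (rule bracket_mono[OF f, of 0]) (auto simp: bracket_def nn M)
  have l: "J / (4 * K) * fs x \<le> (dens_op ^^ (n + 3)) f x" if x: "x \<in> {0<..2}" for x
    using cube_ge[OF continuous_on_dens_op_pow[OF f] dens_op_pow_nonneg[of f, OF nn] x, of n]
    by (simp add: J_def funpow_add add.commute[of n])
  show ?thesis
  proof
    show "0 < J / (4 * K * lam ^ (n + 3))" using J K lam by simp
    show "bracket f (n + 3) (J / (4 * K * lam ^ (n + 3))) M"
      using u l lam by (simp add: bracket_def)
  qed
qed

text \<open>\<open>fs\<close> has mass 1, so integrating a bracket bounds the mass. With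
  \<open>0 \<le> m\<close> the iterate is nonnegative and the upper bound dominates its absolute
  value.\<close>

lemma bracket_integral:
  assumes f: "continuous_on {0<..2} f" and b: "bracket f n m M" and m: "0 \<le> m"
  shows "set_integrable lborel {0<..2} ((dens_op ^^ n) f)"
    and "m * lam ^ n \<le> (LBINT x:{0<..2}. (dens_op ^^ n) f x)"
    and "(LBINT x:{0<..2}. (dens_op ^^ n) f x) \<le> M * lam ^ n"
proof -
  have i: "set_integrable lborel {0<..2} (\<lambda>x. a * fs x)" for a using integrable by simp
  show 1: "set_integrable lborel {0<..2} ((dens_op ^^ n) f)"
  proof (rule set_integrable_bound[OF i[of "M * lam ^ n"]])
    show "set_borel_measurable lborel {0<..2} ((dens_op ^^ n) f)"
      unfolding set_borel_measurable_def
      using borel_measurable_continuous_on_indicator[OF _ continuous_on_dens_op_pow[OF f, of n]]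
      by simp
    show "AE x in lborel. x \<in> {0<..2} \<longrightarrow> norm ((dens_op ^^ n) f x) \<le> norm (M * lam ^ n * fs x)"
    proof (intro AE_I2 impI)
      fix x :: real assume x: "x \<in> {0<..2}"
      have "0 \<le> m * lam ^ n * fs x" using m lam nonneg[OF x] by simp
      then show "norm ((dens_op ^^ n) f x) \<le> norm (M * lam ^ n * fs x)"
        using b x by (force simp: bracket_def)
    qed
  qed
  show "m * lam ^ n \<le> (LBINT x:{0<..2}. (dens_op ^^ n) f x)"
    using set_integral_mono[OF i[of "m * lam ^ n"] 1] b by (simp add: integral bracket_def)
  show "(LBINT x:{0<..2}. (dens_op ^^ n) f x) \<le> M * lam ^ n"
    using set_integral_mono[OF 1 i[of "M * lam ^ n"]] b by (simp add: integral bracket_def)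
qed

text \<open>A narrow bracket confines the mass as well as the values, so the normalized iterate is
  close to \<open>fs\<close> relative to \<open>fs\<close> itself on all of (0,2]. Compactness of
  \<open>C\<close> bounds \<open>fs\<close> and turns this into an absolute error.\<close>

lemma normalized_iterates_uniform_limit:
  assumes f: "continuous_on {0<..2} f" and nn: "\<And>x. x \<in> {0<..2} \<Longrightarrow> 0 \<le> f x"
    and M: "\<And>x. x \<in> {0<..2} \<Longrightarrow> f x \<le> M * fs x" and nz: "y \<in> {0<..2}" "f y \<noteq> 0"
    and C: "compact C" "C \<subseteq> {0<..2}"
  shows "uniform_limit C (\<lambda>n x. (dens_op ^^ n) f x / (LBINT x:{0<..2}. (dens_op ^^ n) f x)) fs
    sequentially"
proof (rule uniform_limitI)
  fix e :: real assume e: "0 < e"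
  obtain n m where nm: "0 < m" "bracket f n m M" using bracket_pos[OF f nn M nz] .
  have "bounded (fs ` C)"
    by (intro compact_imp_bounded compact_continuous_image continuous_on_subset[OF cont] C)
  then obtain B where B: "0 < B" "\<And>x. x \<in> C \<Longrightarrow> fs x \<le> B"
    unfolding bounded_pos by force
  \<comment> \<open>Chosen so that the error \<open>d * L * B\<close> is half of
    \<open>e * (m * L)\<close>, where \<open>m * L\<close> bounds the mass from below.\<close>
  define d where "d = e * m / (2 * B)"
  have d: "0 < d" using e nm B by (simp add: d_def)
  obtain N where N: "\<And>k. N \<le> k \<Longrightarrow> \<exists>m' M'. m \<le> m' \<and> M' - m' \<le> d \<and> bracket f k m' M'"
    using bracket_squeeze[OF f nm(2) d] by blast
  have "dist ((dens_op ^^ k) f x / (LBINT x:{0<..2}. (dens_op ^^ k) f x)) (fs x) < e"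
    if k: "N \<le> k" and x: "x \<in> C" for k x
  proof -
    obtain m' M' where m': "m \<le> m'" "M' - m' \<le> d" "bracket f k m' M'" using N[OF k] by blast
    define Z where "Z = (LBINT x:{0<..2}. (dens_op ^^ k) f x)"
    define L where "L = lam ^ k"
    define F where "F = (dens_op ^^ k) f x"
    have L: "0 < L" using lam by (simp add: L_def)
    have Z: "m' * L \<le> Z" "Z \<le> M' * L"
      using bracket_integral[OF f m'(3)] m' nm by (auto simp: Z_def L_def)
    have x2: "x \<in> {0<..2}" using x C by auto
    have F: "m' * L * fs x \<le> F" "F \<le> M' * L * fs x"
      using m'(3) x2 by (auto simp: bracket_def F_def L_def)
    have mZ: "m * L \<le> Z" using m'(1) L Z mult_right_mono[of m m' L] by linarith
    have Z0: "0 < Z" using mZ L nm(1) mult_pos_pos[of m L] by linarith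
    have fx: "0 \<le> fs x" using nonneg[OF x2] .
    have "\<bar>F - Z * fs x\<bar> \<le> (M' * L - m' * L) * fs x"
    proof -
      have "m' * L * fs x \<le> Z * fs x" "Z * fs x \<le> M' * L * fs x"
        using Z fx by (auto intro: mult_right_mono)
      with F show ?thesis by (simp add: abs_le_iff left_diff_distrib)
    qed
    also have "\<dots> \<le> (d * L) * B"
      using m'(2) L fx B x d by (intro mult_mono) (auto simp flip: left_diff_distrib)
    also have "\<dots> = e / 2 * (m * L)" using B by (simp add: d_def)
    also have "\<dots> \<le> e / 2 * Z" using mZ e by (intro mult_left_mono) auto
    also have "\<dots> < e * Z" using e Z0 by simp
    finally have "\<bar>F - Z * fs x\<bar> / Z < e" using Z0 by (simp add: field_simps)
    moreover have "F / Z - fs x = (F - Z * fs x) / Z" using Z0 by (simp add: field_simps)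
    ultimately show ?thesis using Z0 by (simp add: dist_real_def flip: Z_def F_def)
  qed
  then show "\<forall>\<^sub>F n in sequentially. \<forall>x\<in>C. dist ((dens_op ^^ n) f x / (LBINT x:{0<..2}. (dens_op ^^ n) f x)) (fs x) < e"
    unfolding eventually_sequentially by blast
qed

end

section \<open>The given density as a positive eigenfunction\<close>

text \<open>On (0,2] the powers of \<open>t - 1\<close> are at most 1 in absolute value. Absolutely
  summable coefficients thus give uniform convergence, hence continuity, and a bounded series; the
  remaining logarithm is controlled by the weight.\<close>

lemma is_fstar_eigenfunction:
  assumes "is_fstar fs"
  obtains K where "dens_op_eigenfunction fs (1 + (LBINT y:{1..2}. fs y)) K"
proof -
  let ?lam = "1 + (LBINT y:{1..2}. fs y)"
  obtain l a where a: "summable (\<lambda>k. \<bar>a k\<bar>)"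
    and fs: "\<And>t. t \<in> {0<..2} \<Longrightarrow> fs t = l * ln t + (\<Sum>k. a k * (t - 1) ^ k)"
    using assms unfolding is_fstar_def by blast
  have nn: "\<And>x. x \<in> {0<..2} \<Longrightarrow> 0 \<le> fs x" and p: "prob_density fs"
    using assms by (auto simp: is_fstar_def prob_density_def)
  have le: "\<bar>a k * (t - 1) ^ k\<bar> \<le> \<bar>a k\<bar>" if "t \<in> {0<..2}" for t k
    using that by (auto simp: abs_mult power_abs intro!: mult_left_le power_le_one)
  have "uniform_limit {0<..2} (\<lambda>n t. \<Sum>k<n. a k * (t - 1) ^ k) (\<lambda>t. \<Sum>k. a k * (t - 1) ^ k) sequentially"
    using le a by (intro Weierstrass_m_test) auto
  then have "continuous_on {0<..2} (\<lambda>t. \<Sum>k. a k * (t - 1) ^ k)"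
    by (rule uniform_limit_theorem[rotated]) (auto intro!: always_eventually continuous_intros)
  then have c: "continuous_on {0<..2} fs"
    by (subst continuous_on_cong[OF refl fs]) (auto intro!: continuous_intros)
  define K where "K = 1 + (\<bar>l\<bar> + (\<Sum>k. \<bar>a k\<bar>))"
  have s0: "0 \<le> (\<Sum>k. \<bar>a k\<bar>)" by (rule suminf_nonneg[OF a]) simp
  have K: "fs x \<le> K * (1 + (ln 2 - ln x))" if x: "x \<in> {0<..2}" for x
  proof -
    have "ln x \<le> ln 2" using x by simp
    moreover have l2: "0 \<le> ln (2::real)" by simp
    ultimately have w: "\<bar>ln x\<bar> \<le> 1 + (ln 2 - ln x)" "1 \<le> 1 + (ln 2 - ln x)"
      using ln_le_minus_one[of 2] by (auto simp: abs_le_iff)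
    have "(\<Sum>k. a k * (x - 1) ^ k) \<le> (\<Sum>k. \<bar>a k\<bar>)"
    proof (rule suminf_le[OF _ summable_comparison_test'[OF a] a])
      show "a k * (x - 1) ^ k \<le> \<bar>a k\<bar>" for k using le[OF x, of k] by simp
    qed (use le[OF x] in auto)
    moreover have "l * ln x \<le> \<bar>l\<bar> * \<bar>ln x\<bar>" by (simp flip: abs_mult)
    ultimately have "fs x \<le> \<bar>l\<bar> * \<bar>ln x\<bar> + (\<Sum>k. \<bar>a k\<bar>) * 1 + 0" using fs[OF x] by simp
    also have "\<dots> \<le> \<bar>l\<bar> * (1 + (ln 2 - ln x)) + (\<Sum>k. \<bar>a k\<bar>) * (1 + (ln 2 - ln x)) + (1 + (ln 2 - ln x))"
      using w s0 by (intro add_mono mult_left_mono) auto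
    finally show ?thesis by (simp add: K_def algebra_simps)
  qed
  have l0: "0 \<le> (LBINT y:{1..2}. fs y)"
    unfolding set_lebesgue_integral_def using nn
    by (intro integral_nonneg_AE AE_I2) (auto simp: indicator_def)
  have "dens_op_eigenfunction fs ?lam K"
  proof
    show "0 < K" using s0 by (simp add: K_def)
    show "dens_op fs x = ?lam * fs x" if "x \<in> {0<..2}" for x
      using assms that by (simp add: is_fstar_def dens_op_def)
  qed (use c nn p K l0 in \<open>auto simp: prob_density_def\<close>)
  then show ?thesis using that by blast
qed

subsection \<open>The operators on measures with a continuous density\<close>

text \<open>An invariant class for \<open>dens_op\<close>. Integrability is a separate clause
  because continuity on (0,2] allows blow-up at 0.\<close>

definition regular_density :: "(real \<Rightarrow> real) \<Rightarrow> bool" where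
  "regular_density f \<longleftrightarrow> continuous_on {0<..2} f \<and> (\<forall>x\<in>{0<..2}. 0 \<le> f x) \<and>
     set_integrable lborel {0<..2} f"

lemma regular_densityD:
  assumes "regular_density f"
  shows "continuous_on {0<..2} f" "x \<in> {0<..2} \<Longrightarrow> 0 \<le> f x" "set_integrable lborel {0<..2} f"
  using assms by (auto simp: regular_density_def)

lemma indicator_mult_measurable:
  fixes h :: "real \<Rightarrow> real"
  assumes "continuous_on {0<..2} h"
  shows "(\<lambda>x. indicator {0<..2} x * h x) \<in> borel_measurable (borel :: real measure)"
  using borel_measurable_continuous_on_indicator[OF _ assms] by simp

text \<open>The value at 0 is arbitrary, so it is patched in as a constant at a single
  point.\<close>

lemma density_measurable:
  fixes h :: "real \<Rightarrow> real"
  assumes "continuous_on {0<..2} h"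
  shows "h \<in> borel_measurable (restrict_space lborel {0..2::real})"
proof -
  note [measurable] = indicator_mult_measurable[OF assms]
  have "(\<lambda>x. if x = 0 then h 0 else indicator {0<..2} x * h x)
      \<in> borel_measurable (restrict_space lborel {0..2})"
    by (intro measurable_restrict_space1) measurable
  then show ?thesis
    by (rule measurable_cong[THEN iffD1, rotated]) (auto simp: space_restrict_space)
qed

lemma dens_measure_sets [simp]: "sets (dens_measure h) = sets (restrict_space borel {0..2})"
  and dens_measure_space [simp]: "space (dens_measure h) = {0..2}"
  by (simp_all add: dens_measure_def sets_restrict_space space_restrict_space)

lemma AE_nonzero: "AE x in restrict_space lborel {0..2::real}. x \<in> {0<..2}"
proof -
  have "AE x in lborel. x \<noteq> (0::real)" by (rule AE_lborel_singleton)
  then show ?thesis by (subst AE_restrict_space_iff) (auto elim!: eventually_mono)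
qed

text \<open>Since 0 is a null point, the restricted space can be traded for plain Lebesgue measure
  and an indicator.\<close>

lemma emeasure_dens_measure:
  assumes h: "continuous_on {0<..2} h" and A: "A \<in> sets (restrict_space borel {0..2})"
  shows "emeasure (dens_measure h) A =
    (\<integral>\<^sup>+x. ennreal (indicator {0<..2} x * h x) * indicator A x \<partial>lborel)"
proof -
  note [measurable] = density_measurable[OF h]
  have "emeasure (dens_measure h) A
      = (\<integral>\<^sup>+x. ennreal (h x) * indicator A x \<partial>restrict_space lborel {0..2})"
    unfolding dens_measure_def using A
    by (intro emeasure_density) (auto simp: sets_restrict_space)
  also have "\<dots> = (\<integral>\<^sup>+x. ennreal (indicator {0<..2} x * h x) * indicator A x \<partial>restrict_space lborel {0..2})"
    by (rule nn_integral_cong_AE, rule eventually_mono[OF AE_nonzero]) auto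
  also have "\<dots> = (\<integral>\<^sup>+x. ennreal (indicator {0<..2} x * h x) * indicator A x \<partial>lborel)"
    by (subst nn_integral_restrict_space) (auto intro!: nn_integral_cong simp: indicator_def)
  finally show ?thesis .
qed

lemma emeasure_dens_measure_space:
  assumes h: "regular_density h"
  shows "emeasure (dens_measure h) {0..2} = ennreal (LBINT x:{0<..2}. h x)"
proof -
  have "emeasure (dens_measure h) {0..2} = (\<integral>\<^sup>+x. ennreal (indicator {0<..2} x * h x) \<partial>lborel)"
    by (subst emeasure_dens_measure[OF regular_densityD(1)[OF h]])
      (auto simp: sets_restrict_space intro!: nn_integral_cong split: split_indicator)
  also have "\<dots> = ennreal (LBINT x:{0<..2}. h x)"
    using regular_densityD[OF h] unfolding set_integrable_def set_lebesgue_integral_def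
    by (subst nn_integral_eq_integral) (auto simp: indicator_def)
  finally show ?thesis .
qed

lemma dens_measure_Mplus:
  assumes "regular_density h"
  shows "dens_measure h \<in> Mplus"
  unfolding Mplus_def
  by (auto intro!: finite_measureI simp: emeasure_dens_measure_space[OF assms])

lemma integral_dens_measure:
  assumes h: "regular_density h"
    and \<phi>: "(\<lambda>x. indicator {0..2} x * \<phi> x) \<in> borel_measurable borel"
  shows "(LINT x|dens_measure h. \<phi> x) = (LBINT x. indicator {0<..2} x * h x * \<phi> x)"
proof -
  note [measurable] = density_measurable[OF regular_densityD(1)[OF h]]
  have "(\<lambda>x. indicator {0..2} x * \<phi> x) \<in> borel_measurable (restrict_space lborel {0..2})"
    using \<phi> by (intro measurable_restrict_space1) simp
  then have [measurable]: "\<phi> \<in> borel_measurable (restrict_space lborel {0..2})"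
    by (rule measurable_cong[THEN iffD1, rotated]) (auto simp: space_restrict_space)
  have "(LINT x|dens_measure h. \<phi> x) = (LINT x|restrict_space lborel {0..2}. h x *\<^sub>R \<phi> x)"
    unfolding dens_measure_def
    by (rule integral_density) (auto intro!: eventually_mono[OF AE_nonzero] regular_densityD(2)[OF h])
  also have "\<dots> = (LINT x|restrict_space lborel {0..2}. indicator {0<..2} x * h x * \<phi> x)"
  proof (rule integral_cong_AE)
    have "(\<lambda>x. indicator {0<..2} x * h x) \<in> borel_measurable (restrict_space lborel {0..2})"
      using indicator_mult_measurable[OF regular_densityD(1)[OF h]] by (intro measurable_restrict_space1) simp
    then show "(\<lambda>x. indicator {0<..2} x * h x * \<phi> x) \<in> borel_measurable (restrict_space lborel {0..2})"
      by measurable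
  qed (auto intro!: eventually_mono[OF AE_nonzero])
  also have "\<dots> = (LBINT x. indicator {0<..2} x * h x * \<phi> x)"
    by (subst integral_restrict_space) (auto intro!: Bochner_Integration.integral_cong simp: indicator_def)
  finally show ?thesis .
qed

lemma pairing_dens_measure:
  assumes "regular_density h" "continuous_on {0..2} g"
  shows "pairing g (dens_measure h) = (LBINT x. indicator {0<..2} x * h x * g x)"
  unfolding pairing_def using borel_measurable_continuous_on_indicator[OF _ assms(2)]
  by (intro integral_dens_measure assms) auto

section \<open>Action of U, V and T on densities\<close>

lemma regular_density_half:
  assumes f: "regular_density f"
  shows "regular_density (\<lambda>x. f (x / 2) / 2)"
proof -
  have "set_integrable lborel {0<..1} f" by (rule set_integrable_subset[OF regular_densityD(3)[OF f]]) auto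
  then have "integrable lborel (\<lambda>x. indicator {0<..1} x *\<^sub>R f x)" by (simp add: set_integrable_def)
  then have "integrable lborel (\<lambda>x. indicator {0<..1} (0 + (1 / 2) * x) *\<^sub>R f (0 + (1 / 2) * x))"
    by (rule lborel_integrable_real_affine) simp
  then have "integrable lborel (\<lambda>x. (indicator {0<..1} (0 + (1 / 2) * x) *\<^sub>R f (0 + (1 / 2) * x)) / 2)"
    by simp
  moreover have "(\<lambda>x. (indicator {0<..1} (0 + (1 / 2) * x) *\<^sub>R f (0 + (1 / 2) * x)) / 2)
      = (\<lambda>x. indicator {0<..2} x *\<^sub>R (f (x / 2) / 2))"
    by (auto simp: indicator_def)
  moreover have "continuous_on {0<..2} (\<lambda>x. f (x / 2) / 2)"
    by (intro continuous_intros continuous_on_compose2[OF regular_densityD(1)[OF f]]) auto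
  ultimately show ?thesis
    using regular_densityD(2)[OF f] by (auto simp: regular_density_def set_integrable_def)
qed

text \<open>By uniqueness in the definite description, it suffices to check the duality for the
  candidate, which is the substitution doubling \<open>x\<close>.\<close>

lemma op_U_dens_measure:
  assumes f: "regular_density f"
  shows "op_U (dens_measure f) = dens_measure (\<lambda>x. f (x / 2) / 2)"
proof -
  have "pairing g (dens_measure (\<lambda>x. f (x / 2) / 2)) = (LINT x:{0..1}|dens_measure f. g (2 * x))"
    if g: "continuous_on {0..2} g" for g
  proof -
    have "(\<lambda>x. indicator {0..1} x *\<^sub>R g (2 * x)) \<in> borel_measurable (borel :: real measure)"
      by (rule borel_measurable_continuous_on_indicator) (auto intro!: continuous_on_compose2[OF g] continuous_intros)
    then have m: "(\<lambda>x. indicator {0..2} x * (indicator {0..1} x *\<^sub>R g (2 * x))) \<in> borel_measurable borel"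
      by measurable
    have "pairing g (dens_measure (\<lambda>x. f (x / 2) / 2))
        = (LBINT x. indicator {0<..2} x * (f (x / 2) / 2) * g x)"
      using pairing_dens_measure[OF regular_density_half[OF f] g] by simp
    also have "\<dots> = \<bar>2\<bar> *\<^sub>R (LBINT x. indicator {0<..2} (0 + 2 * x) * (f ((0 + 2 * x) / 2) / 2) * g (0 + 2 * x))"
      by (rule lborel_integral_real_affine) simp
    also have "\<dots> = (LBINT x. 2 * (indicator {0<..2} (0 + 2 * x) * (f ((0 + 2 * x) / 2) / 2) * g (0 + 2 * x)))"
      by simp
    also have "\<dots> = (LBINT x. indicator {0<..2} x * f x * (indicator {0..1} x *\<^sub>R g (2 * x)))"
      by (intro Bochner_Integration.integral_cong) (auto simp: indicator_def)
    also have "\<dots> = (LINT x:{0..1}|dens_measure f. g (2 * x))"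
      unfolding set_lebesgue_integral_def by (rule integral_dens_measure[OF f m, symmetric])
    finally show ?thesis .
  qed
  then show ?thesis
    unfolding op_U_def
    by (intro the1_equality op_U_ex1 conjI dens_measure_Mplus f regular_density_half allI impI)
qed

text \<open>The region \<open>1 < y \<le> 2\<close>, \<open>0 \<le> x \<le> 2 * (y - 1)\<close> is
  sliced in both directions: fixed \<open>x\<close> gives the kernel of the density operator, fixed
  \<open>y\<close> the functional that defines V.\<close>

lemma kernel_Fubini:
  fixes f g :: "real \<Rightarrow> real"
  assumes f: "regular_density f" and g: "continuous_on {0..2} g"
  shows "integrable lborel (\<lambda>x. indicator {0..2} x * g x * (LBINT y:{1 + x / 2..2}. f y / (y - 1)))"
    and "(LBINT x. indicator {0..2} x * g x * (LBINT y:{1 + x / 2..2}. f y / (y - 1)))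
      = (LBINT y. indicator {0<..2} y * f y *
          (indicator {1<..2} y * (1 / (y - 1) * (LBINT x:{0..2 * (y - 1)}. g x))))"
    and "(\<lambda>y. indicator {1<..2} y * (1 / (y - 1) * (LBINT x:{0..2 * (y - 1)}. g x)))
      \<in> borel_measurable borel"
proof -
  define F where "F = (\<lambda>y. indicator {0<..2} y * f y)"
  define G where "G = (\<lambda>x. indicator {0..2} x * g x)"
  have [measurable]: "F \<in> borel_measurable borel" "G \<in> borel_measurable borel"
    using borel_measurable_continuous_on_indicator[OF _ regular_densityD(1)[OF f]] borel_measurable_continuous_on_indicator[OF _ g]
    by (auto simp: F_def G_def)
  \<comment> \<open>The region as one 0-1 valued function, jointly measurable in both orders of the
    variables.\<close>
  define R :: "real \<Rightarrow> real \<Rightarrow> real" where "R = (\<lambda>y x. of_bool (1 < y \<and> y \<le> 2 \<and> 0 \<le> x \<and> x \<le> 2 * (y - 1)))"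
  have [measurable]: "(\<lambda>p. R (fst p) (snd p)) \<in> borel_measurable (borel \<Otimes>\<^sub>M borel)"
    "(\<lambda>p. R (snd p) (fst p)) \<in> borel_measurable (borel \<Otimes>\<^sub>M borel)"
    "R y \<in> borel_measurable borel" for y
    unfolding R_def by measurable
  define P where "P = (\<lambda>y x. R y x * (F y / (y - 1)) * G x)"
  have R_y: "indicator {1<..2} y * (LBINT x:{0..2 * (y - 1)}. g x) = (LBINT x. R y x * G x)" for y
  proof (cases "y \<in> {1<..2}")
    case True
    then show ?thesis
      by (auto simp: set_lebesgue_integral_def R_def G_def indicator_def intro!: Bochner_Integration.integral_cong)
  qed (auto simp: R_def)
  show "(\<lambda>y. indicator {1<..2} y * (1 / (y - 1) * (LBINT x:{0..2 * (y - 1)}. g x))) \<in> borel_measurable borel"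
  proof -
    have "(\<lambda>y. 1 / (y - 1) * (LBINT x. R y x * G x)) \<in> borel_measurable borel" by measurable
    then show ?thesis unfolding R_y[symmetric] by (simp add: mult_ac)
  qed
  obtain B where B: "0 < B" "\<And>x. x \<in> {0..2} \<Longrightarrow> \<bar>g x\<bar> \<le> B"
    using compact_imp_bounded[OF compact_continuous_image[OF g compact_Icc]]
    unfolding bounded_pos by force
  have Pint: "integrable (lborel \<Otimes>\<^sub>M lborel) (\<lambda>(y, x). P y x)"
  proof (rule lborel_pair.Fubini_integrable)
    show "(\<lambda>(y, x). P y x) \<in> borel_measurable (lborel \<Otimes>\<^sub>M lborel)"
      unfolding P_def split_beta' by measurable
    have Ri: "integrable lborel (\<lambda>x. R y x * c)" "(LBINT x. R y x * c) = 2 * (y - 1) * of_bool (1 < y \<and> y \<le> 2) * c" for y c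
    proof -
      have e: "R y x * c = indicator {0..2 * (y - 1)} x *\<^sub>R (of_bool (1 < y \<and> y \<le> 2) * c)" for x
        by (auto simp: R_def indicator_def)
      show "integrable lborel (\<lambda>x. R y x * c)" unfolding e
        by (intro integrable_real_indicator integrable_scaleR_left) (auto simp: emeasure_lborel_Icc_eq)
      show "(LBINT x. R y x * c) = 2 * (y - 1) * of_bool (1 < y \<and> y \<le> 2) * c" unfolding e
        by (auto simp: content_real)
    qed
    have Pb: "norm (P y x) \<le> R y x * (F y / (y - 1) * B)" for y x
    proof (cases "1 < y \<and> y \<le> 2 \<and> 0 \<le> x \<and> x \<le> 2 * (y - 1)")
      case True
      then have "\<bar>g x\<bar> \<le> B" "0 \<le> f y" "x \<le> 2" by (auto intro: B regular_densityD(2)[OF f])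
      then show ?thesis using True
        by (auto simp: P_def R_def F_def G_def abs_mult intro!: divide_right_mono mult_left_mono)
    next
      case False
      then have "R y x = 0" by (simp only: R_def of_bool_eq)
      then show ?thesis by (simp add: P_def)
    qed
    have Pm: "(\<lambda>x. P y x) \<in> borel_measurable lborel" for y unfolding P_def by measurable
    have Pi: "integrable lborel (\<lambda>x. P y x)" for y
      by (rule Bochner_Integration.integrable_bound[OF Ri(1)[of y "F y / (y - 1) * B"] Pm])
        (intro AE_I2 order_trans[OF Pb], simp only: real_norm_def abs_ge_self)
    then show "AE y in lborel. integrable lborel (\<lambda>x. case (y, x) of (y, x) \<Rightarrow> P y x)" by simp
    \<comment> \<open>The slice at \<open>y\<close> has length \<open>2 * (y - 1)\<close>, which
      cancels the pole and leaves the integrable majorant \<open>2 * B * F y\<close>.\<close>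
    have "integrable lborel (\<lambda>y. LBINT x. norm (P y x))"
    proof (rule Bochner_Integration.integrable_bound)
      show "integrable lborel (\<lambda>y. 2 * B * F y)" using regular_densityD(3)[OF f] by (simp add: F_def set_integrable_def)
      show "(\<lambda>y. LBINT x. norm (P y x)) \<in> borel_measurable lborel"
        unfolding P_def by measurable
      show "AE y in lborel. norm (LBINT x. norm (P y x)) \<le> norm (2 * B * F y)"
      proof (rule AE_I2)
        fix y :: real
        have "(LBINT x. norm (P y x)) \<le> (LBINT x. R y x * (F y / (y - 1) * B))"
          by (intro integral_mono Pb Ri integrable_norm Pi)
        also have "\<dots> \<le> 2 * B * \<bar>F y\<bar>"
        proof (cases "1 < y \<and> y \<le> 2")
          case True
          then have "2 * (y - 1) * (F y / (y - 1) * B) = 2 * B * F y" by (simp add: field_simps)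
          also have "\<dots> \<le> 2 * B * \<bar>F y\<bar>" using B(1) by simp
          finally show ?thesis unfolding Ri(2) using True by simp
        next
          case False
          then show ?thesis unfolding Ri(2) using B(1) by (simp only: of_bool_eq) simp
        qed
        finally show "norm (LBINT x. norm (P y x)) \<le> norm (2 * B * F y)"
          using B by (simp add: abs_mult)
      qed
    qed
    then show "integrable lborel (\<lambda>y. LBINT x. norm (case (y, x) of (y, x) \<Rightarrow> P y x))" by simp
  qed
  have P_x: "(LBINT y. P y x) = indicator {0..2} x * g x * (LBINT y:{1 + x / 2..2}. f y / (y - 1))"
    for x
  proof -
    \<comment> \<open>For \<open>x = 0\<close>, \<open>y = 1\<close> the right-hand side vanishes because \<open>f 1 / 0 = 0\<close>.\<close>
    have "P y x = indicator {0..2} x * g x * (indicator {1 + x / 2..2} y *\<^sub>R (f y / (y - 1)))" for y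
      by (cases "y = 1") (auto simp: P_def R_def F_def G_def indicator_def)
    then show ?thesis by (simp only: set_lebesgue_integral_def integral_mult_right_zero)
  qed
  have P_y: "(LBINT x. P y x) = indicator {0<..2} y * f y *
      (indicator {1<..2} y * (1 / (y - 1) * (LBINT x:{0..2 * (y - 1)}. g x)))" for y
  proof -
    have "P y x = F y / (y - 1) * (R y x * G x)" for x by (simp add: P_def)
    then have "(LBINT x. P y x) = F y / (y - 1) * (LBINT x. R y x * G x)"
      by (simp only: integral_mult_right_zero)
    then show ?thesis unfolding R_y[symmetric] by (simp add: F_def mult_ac)
  qed
  show "integrable lborel (\<lambda>x. indicator {0..2} x * g x * (LBINT y:{1 + x / 2..2}. f y / (y - 1)))"
    using lborel_pair.integrable_snd[OF Pint] by (simp add: P_x)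
  show "(LBINT x. indicator {0..2} x * g x * (LBINT y:{1 + x / 2..2}. f y / (y - 1)))
      = (LBINT y. indicator {0<..2} y * f y *
          (indicator {1<..2} y * (1 / (y - 1) * (LBINT x:{0..2 * (y - 1)}. g x))))"
    using lborel_pair.Fubini_integral[OF Pint] by (simp add: P_x P_y)
qed

lemma regular_density_kernel_integral:
  assumes f: "regular_density f"
  shows "regular_density (\<lambda>x. LBINT y:{1 + x / 2..2}. f y / (y - 1))"
  unfolding regular_density_def
proof (intro conjI ballI)
  show "set_integrable lborel {0<..2} (\<lambda>x. LBINT y:{1 + x / 2..2}. f y / (y - 1))"
  proof (rule set_integrable_subset)
    show "set_integrable lborel {0..2} (\<lambda>x. LBINT y:{1 + x / 2..2}. f y / (y - 1))"
      using kernel_Fubini(1)[OF f, of "\<lambda>_. 1"] by (simp add: set_integrable_def)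
  qed auto
qed (auto intro!: kernel_integral_nonneg continuous_on_kernel_integral regular_densityD[OF f])

text \<open>The duality is again checked for the candidate, now by exchanging the order of
  integration.\<close>

lemma op_V_dens_measure:
  assumes f: "regular_density f"
  shows "op_V (dens_measure f) = dens_measure (\<lambda>x. LBINT y:{1 + x / 2..2}. f y / (y - 1))"
    (is "_ = dens_measure ?H")
proof -
  note H = regular_density_kernel_integral[OF f]
  have "pairing g (dens_measure ?H)
      = (LINT x:{1<..2}|dens_measure f. 1 / (x - 1) * (LBINT y:{0..2 * (x - 1)}. g y))"
    if g: "continuous_on {0..2} g" for g
  proof -
    let ?\<phi> = "\<lambda>y. indicator {1<..2} y * (1 / (y - 1) * (LBINT x:{0..2 * (y - 1)}. g x))"
    note F = kernel_Fubini[OF f g]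
    have "(\<lambda>x. indicator {0..2} x *\<^sub>R ?\<phi> x) \<in> borel_measurable borel"
      by (intro borel_measurable_scaleR borel_measurable_indicator F(3)) auto
    then have m: "(\<lambda>x. indicator {0..2} x * ?\<phi> x) \<in> borel_measurable borel" by simp
    have "pairing g (dens_measure ?H) = (LBINT x. indicator {0<..2} x * ?H x * g x)"
      using pairing_dens_measure[OF H g] by simp
    also have "\<dots> = (LBINT x. indicator {0..2} x * g x * ?H x)"
    proof (rule integral_cong_AE)
      have [measurable]: "(\<lambda>x. indicator {0<..2} x * ?H x) \<in> borel_measurable borel"
        "(\<lambda>x. indicator {0..2} x * g x) \<in> borel_measurable borel"
        using indicator_mult_measurable[OF regular_densityD(1)[OF H]]
          borel_measurable_continuous_on_indicator[OF _ g] by auto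
      have "(\<lambda>x. indicator {0<..2} x * ?H x * (indicator {0..2} x * g x)) \<in> borel_measurable lborel"
        by measurable
      then show "(\<lambda>x. indicator {0<..2} x * ?H x * g x) \<in> borel_measurable lborel"
        by (rule measurable_cong[THEN iffD1, rotated]) (auto simp: indicator_def)
      show "AE x in lborel. indicator {0<..2} x * ?H x * g x = indicator {0..2} x * g x * ?H x"
        by (rule eventually_mono[OF AE_lborel_singleton[of 0]]) (auto simp: indicator_def)
    qed (use F(1) in auto)
    also have "\<dots> = (LINT x|dens_measure f. ?\<phi> x)"
      unfolding F(2) by (rule integral_dens_measure[OF f m, symmetric])
    finally show ?thesis by (simp add: set_lebesgue_integral_def)
  qed
  then show ?thesis
    unfolding op_V_def
    by (intro the1_equality op_V_ex1 conjI dens_measure_Mplus f H allI impI)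
qed

lemma regular_density_dens_op:
  assumes f: "regular_density f"
  shows "regular_density (dens_op f)"
  using set_integral_add(1)[OF regular_densityD(3)[OF regular_density_half[OF f]]
      regular_densityD(3)[OF regular_density_kernel_integral[OF f]]]
    continuous_on_dens_op[OF regular_densityD(1)[OF f]] dens_op_nonneg[of f] regular_densityD(2)[OF f]
  by (auto simp: regular_density_def dens_op_def[abs_def])

lemma op_T_dens_measure:
  assumes f: "regular_density f"
  shows "op_T (dens_measure f) = dens_measure (dens_op f)"
proof (rule measure_eqI)
  let ?H = "\<lambda>x. LBINT y:{1 + x / 2..2}. f y / (y - 1)"
  note M = dens_measure_Mplus[OF f]
  note U = regular_density_half[OF f] and V = regular_density_kernel_integral[OF f]
  note Uc = regular_densityD(1)[OF U] and Vc = regular_densityD(1)[OF V]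
  show s: "sets (op_T (dens_measure f)) = sets (dens_measure (dens_op f))"
    using op_T_Mplus[OF M] by (simp add: Mplus_def)
  fix A assume "A \<in> sets (op_T (dens_measure f))"
  then have A: "A \<in> sets (restrict_space borel {0..2})" using s by simp
  have [measurable]: "A \<in> sets borel" using A by (auto simp: sets_restrict_space)
  note [measurable] = indicator_mult_measurable[OF Uc] indicator_mult_measurable[OF Vc]
  have "emeasure (op_T (dens_measure f)) A =
      (\<integral>\<^sup>+x. ennreal (indicator {0<..2} x * (f (x / 2) / 2)) * indicator A x \<partial>lborel) +
      (\<integral>\<^sup>+x. ennreal (indicator {0<..2} x * ?H x) * indicator A x \<partial>lborel)"
    by (simp only: emeasure_op_T[OF M A] op_U_dens_measure[OF f] op_V_dens_measure[OF f]
      emeasure_dens_measure[OF Uc A] emeasure_dens_measure[OF Vc A])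
  also have "\<dots> = (\<integral>\<^sup>+x. ennreal (indicator {0<..2} x * (f (x / 2) / 2)) * indicator A x +
      ennreal (indicator {0<..2} x * ?H x) * indicator A x \<partial>lborel)"
    by (rule nn_integral_add[symmetric]) measurable
  also have "\<dots> = (\<integral>\<^sup>+x. ennreal (indicator {0<..2} x * dens_op f x) * indicator A x \<partial>lborel)"
    using regular_densityD(2)[OF U] regular_densityD(2)[OF V]
    by (intro nn_integral_cong) (auto simp: indicator_def dens_op_def ennreal_plus)
  also have "\<dots> = emeasure (dens_measure (dens_op f)) A"
    by (rule emeasure_dens_measure[OF continuous_on_dens_op[OF regular_densityD(1)[OF f]] A, symmetric])
  finally show "emeasure (op_T (dens_measure f)) A = emeasure (dens_measure (dens_op f)) A" .
qed

section \<open>Normalized iteration and uniqueness of continuous densities\<close>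

lemma op_That_dens_measure:
  assumes f: "regular_density f" and Z: "0 < (LBINT x:{0<..2}. dens_op f x)"
  shows "op_That (dens_measure f) = dens_measure (\<lambda>x. dens_op f x / (LBINT x:{0<..2}. dens_op f x))"
    (is "_ = dens_measure (\<lambda>x. _ / ?Z)")
proof -
  note Tf = regular_density_dens_op[OF f]
  note Tc = regular_densityD(1)[OF Tf]
  have c: "continuous_on {0<..2} (\<lambda>x. dens_op f x / ?Z)"
    using Z by (intro continuous_intros Tc) auto
  \<comment> \<open>Positive mass matters: division by 0 gives infinity in \<open>ennreal\<close>
    but 0 in the reals.\<close>
  have r: "1 / ennreal ?Z = ennreal (1 / ?Z)" using Z by (simp add: divide_ennreal flip: ennreal_1)
  show ?thesis
    unfolding op_That_def op_T_dens_measure[OF f] emeasure_dens_measure_space[OF Tf] r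
  proof (rule measure_eqI)
    fix A assume "A \<in> sets (scale_measure (ennreal (1 / ?Z)) (dens_measure (dens_op f)))"
    then have A: "A \<in> sets (restrict_space borel {0..2})" by simp
    have [measurable]: "A \<in> sets borel" using A by (auto simp: sets_restrict_space)
    note [measurable] = indicator_mult_measurable[OF Tc]
    have "emeasure (scale_measure (ennreal (1 / ?Z)) (dens_measure (dens_op f))) A
        = ennreal (1 / ?Z) * (\<integral>\<^sup>+x. ennreal (indicator {0<..2} x * dens_op f x) * indicator A x \<partial>lborel)"
      by (simp only: emeasure_scale_measure emeasure_dens_measure[OF Tc A])
    also have "\<dots> = (\<integral>\<^sup>+x. ennreal (1 / ?Z) * (ennreal (indicator {0<..2} x * dens_op f x) * indicator A x) \<partial>lborel)"
      by (rule nn_integral_cmult[symmetric]) measurable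
    also have "\<dots> = emeasure (dens_measure (\<lambda>x. dens_op f x / ?Z)) A"
      unfolding emeasure_dens_measure[OF c A]
      using Z by (intro nn_integral_cong) (auto simp: indicator_def simp flip: ennreal_mult')
    finally show "emeasure (scale_measure (ennreal (1 / ?Z)) (dens_measure (dens_op f))) A
        = emeasure (dens_measure (\<lambda>x. dens_op f x / ?Z)) A" .
  qed simp
qed

lemma dens_measure_cong:
  assumes h: "continuous_on {0<..2} h" and eq: "\<And>x. x \<in> {0<..2} \<Longrightarrow> h x = k x"
  shows "dens_measure h = dens_measure k"
proof (rule measure_eqI)
  fix A assume "A \<in> sets (dens_measure h)"
  then have A: "A \<in> sets (restrict_space borel {0..2})" by simp
  have k: "continuous_on {0<..2} k" using h by (subst continuous_on_cong[OF refl eq[symmetric]]) auto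
  show "emeasure (dens_measure h) A = emeasure (dens_measure k) A"
    unfolding emeasure_dens_measure[OF h A] emeasure_dens_measure[OF k A]
    using eq by (intro nn_integral_cong) (auto simp: indicator_def)
qed simp

lemma regular_density_divide:
  assumes "regular_density f" "0 < z"
  shows "regular_density (\<lambda>x. f x / z)"
  using assms by (auto simp: regular_density_def intro!: continuous_intros)

lemma regular_density_dens_op_pow: "regular_density f \<Longrightarrow> regular_density ((dens_op ^^ n) f)"
  by (induction n) (auto intro: regular_density_dens_op)

text \<open>Normalizations telescope: by linearity the mass \<open>z\<close> of the previous iterate
  cancels, and only the last mass remains.\<close>

lemma op_That_pow_dens_measure:
  assumes f: "regular_density f" and one: "(LBINT x:{0<..2}. f x) = 1"
    and Z: "\<And>n. 0 < (LBINT x:{0<..2}. (dens_op ^^ n) f x)"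
  shows "(op_That ^^ n) (dens_measure f)
    = dens_measure (\<lambda>x. (dens_op ^^ n) f x / (LBINT x:{0<..2}. (dens_op ^^ n) f x))"
proof (induction n)
  case 0
  then show ?case by (simp add: one)
next
  case (Suc n)
  let ?F = "(dens_op ^^ n) f"
  define z where "z = (LBINT x:{0<..2}. ?F x)"
  define w where "w = (LBINT x:{0<..2}. dens_op ?F x)"
  have z: "0 < z" and w: "0 < w" using Z[of n] Z[of "Suc n"] by (simp_all add: z_def w_def)
  note F = regular_density_dens_op_pow[OF f, of n]
  note Fz = regular_density_divide[OF F z]
  note Fc = regular_densityD(1)[OF F]
  have T: "dens_op (\<lambda>x. ?F x / z) x = dens_op ?F x / z" if "x \<in> {0<..2}" for x
    using dens_op_diff[OF Fc Fc that, of "1 / z" 0] by simp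
  have I: "(LBINT x:{0<..2}. dens_op (\<lambda>x. ?F x / z) x) = w / z"
    using T by (subst set_lebesgue_integral_cong[of _ _ _ "\<lambda>x. dens_op ?F x / z"]) (auto simp: w_def)
  have "(op_That ^^ Suc n) (dens_measure f) = op_That (dens_measure (\<lambda>x. ?F x / z))"
    by (simp add: Suc z_def)
  also have "\<dots> = dens_measure (\<lambda>x. dens_op (\<lambda>x. ?F x / z) x / (w / z))"
    using op_That_dens_measure[OF Fz] z w by (simp add: I)
  also have "\<dots> = dens_measure (\<lambda>x. dens_op ?F x / w)"
    using z w T
    by (intro dens_measure_cong continuous_intros regular_densityD(1)[OF regular_density_dens_op[OF Fz]]) auto
  finally show ?case by (simp add: w_def)
qed

text \<open>Equal measures have densities equal almost everywhere, and continuity removes the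
  exceptional set. Hence the limit statement may speak of arbitrary continuous densities.\<close>

lemma continuous_density_unique:
  assumes h: "continuous_density h \<mu>" and k: "continuous_density k \<mu>" and x: "x \<in> {0<..2}"
  shows "h x = k x"
proof -
  have ch: "continuous_on {0<..2} h" and ck: "continuous_on {0<..2} k"
    and nh: "\<And>x. x \<in> {0<..2} \<Longrightarrow> 0 \<le> h x" and nk: "\<And>x. x \<in> {0<..2} \<Longrightarrow> 0 \<le> k x"
    and e: "dens_measure h = dens_measure k" and \<mu>: "\<mu> = dens_measure h"
    using h k by (auto simp: continuous_density_def)
  \<comment> \<open>Gives a nondegenerate compact interval \<open>{a..2}\<close> that contains
    \<open>x\<close> and avoids 0.\<close>
  define a where "a = x / 2"
  have a: "0 < a" "a < x" "x \<le> 2" using x by (auto simp: a_def)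
  have "(LBINT y:{a..2}. \<bar>h y - k y\<bar>) = 0"
  proof -
    have "AE y in lborel. ennreal (indicator {0<..2} y * h y) = ennreal (indicator {0<..2} y * k y)"
    proof (rule sigma_finite_measure.density_unique[OF lborel.sigma_finite_measure_axioms])
      note [measurable] = indicator_mult_measurable[OF ch] indicator_mult_measurable[OF ck]
      show m: "(\<lambda>y. ennreal (indicator {0<..2} y * h y)) \<in> borel_measurable lborel"
        "(\<lambda>y. ennreal (indicator {0<..2} y * k y)) \<in> borel_measurable lborel"
        by measurable
      show "density lborel (\<lambda>y. ennreal (indicator {0<..2} y * h y))
          = density lborel (\<lambda>y. ennreal (indicator {0<..2} y * k y))"
      proof (rule measure_eqI)
        fix B assume "B \<in> sets (density lborel (\<lambda>y. ennreal (indicator {0<..2} y * h y)))"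
        then have B: "B \<in> sets lborel" by simp
        then have A: "B \<inter> {0..2} \<in> sets (restrict_space borel {0..2})"
          by (auto simp: sets_restrict_space)
        have "emeasure (density lborel (\<lambda>y. ennreal (indicator {0<..2} y * u y))) B
            = emeasure (dens_measure u) (B \<inter> {0..2})" if "continuous_on {0<..2} u" for u
          unfolding emeasure_dens_measure[OF that A]
          using indicator_mult_measurable[OF that] B
          by (subst emeasure_density) (auto intro!: nn_integral_cong simp: indicator_def)
        then show "emeasure (density lborel (\<lambda>y. ennreal (indicator {0<..2} y * h y))) B
            = emeasure (density lborel (\<lambda>y. ennreal (indicator {0<..2} y * k y))) B"
          using ch ck e by simp
      qed simp
    qed
    then have "AE y in lborel. y \<in> {a..2} \<longrightarrow> \<bar>h y - k y\<bar> = 0"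
      using a nh nk by (auto elim!: eventually_mono)
    then show ?thesis
      unfolding set_lebesgue_integral_def
      by (intro integral_eq_zero_AE) (auto elim!: eventually_mono simp: indicator_def)
  qed
  then have "\<bar>h x - k x\<bar> = 0"
    by (intro set_integral_eq_0_continuous[where a = a and b = 2 and f = "\<lambda>y. \<bar>h y - k y\<bar>"])
      (use a in \<open>auto intro!: continuous_intros continuous_on_subset[OF ch] continuous_on_subset[OF ck]\<close>)
  then show ?thesis by simp
qed

section \<open>Positive masses and the convergence theorem\<close>

context dens_op_eigenfunction
begin

text \<open>An iterate of mass 0 vanishes identically by continuity, and so do all later ones,
  whereas \<open>bracket_pos\<close> makes late iterates positive. Thus normalization never divides
  by 0.\<close>

lemma iterate_integral_pos:
  assumes f: "regular_density f"
    and M: "\<And>x. x \<in> {0<..2} \<Longrightarrow> f x \<le> M * fs x" and nz: "y \<in> {0<..2}" "f y \<noteq> 0"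
  shows "0 < (LBINT x:{0<..2}. (dens_op ^^ n) f x)"
proof (rule ccontr)
  let ?F = "(dens_op ^^ n) f"
  assume np: "\<not> 0 < (LBINT x:{0<..2}. ?F x)"
  note fc = regular_densityD(1)[OF f] and F = regular_density_dens_op_pow[OF f, of n]
  obtain k m where k: "0 < m" "bracket f k m M"
    using bracket_pos[OF fc regular_densityD(2)[OF f] M nz] .
  have "?F x = 0" if x: "x \<in> {0<..2}" for x
  proof -
    define a where "a = x / 2"
    have a: "0 < a" "a < x" "x \<le> 2" using x by (auto simp: a_def)
    have i: "set_integrable lborel {a..2} ?F"
      by (rule set_integrable_subset[OF regular_densityD(3)[OF F]]) (use a in auto)
    have "(LBINT x:{a..2}. ?F x) \<le> (LBINT x:{0<..2}. ?F x)"
      using i regular_densityD(2,3)[OF F] a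
      unfolding set_lebesgue_integral_def set_integrable_def
      by (intro integral_mono) (auto simp: indicator_def)
    moreover have "0 \<le> (LBINT x:{a..2}. ?F x)"
      unfolding set_lebesgue_integral_def using regular_densityD(2)[OF F] a
      by (intro integral_nonneg_AE AE_I2) (auto simp: indicator_def)
    ultimately have z: "(LBINT x:{a..2}. ?F x) = 0" using np by linarith
    show ?thesis
      by (rule set_integral_eq_0_continuous[OF _ _ z])
        (use a regular_densityD(2)[OF F] in \<open>auto intro: continuous_on_subset[OF regular_densityD(1)[OF F]]\<close>)
  qed
  \<comment> \<open>A bracket with both bounds 0 says that the iterate vanishes; its persistence
    clashes with the positive bracket at index \<open>n + k\<close>.\<close>
  then have "bracket f n 0 0" by (simp add: bracket_def)
  from bracket_mono[OF fc this, of "n + k"] have "(dens_op ^^ (n + k)) f 2 \<le> 0"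
    by (simp add: bracket_def)
  moreover have "m * lam ^ (n + k) * fs 2 \<le> (dens_op ^^ (n + k)) f 2"
    using bracket_mono[OF fc k(2), of "n + k"] by (simp add: bracket_def)
  moreover have "0 < m * lam ^ (n + k) * fs 2" using k lam pos[of 2] by simp
  ultimately show False by linarith
qed

end

text \<open>The first conjunct keeps the second from being vacuous: continuous densities exist at
  every step, and any choice of them converges.\<close>

theorem theorem6p4:
  fixes f g fstar :: "real \<Rightarrow> real" and D :: real
  assumes fstar: "is_fstar fstar"
    and g: "continuous_on {0..2} g"
    and f: "\<And>x. x \<in> {0<..2} \<Longrightarrow> f x = D * ln x + g x"
    and dens: "prob_density f"
  shows "(\<forall>n. \<exists>h. continuous_density h ((op_That ^^ n) (dens_measure f))) \<and>
    (\<forall>h. (\<forall>n. continuous_density (h n) ((op_That ^^ n) (dens_measure f))) \<longrightarrow>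
      (\<forall>K. compact K \<and> K \<subseteq> {0<..2} \<longrightarrow> uniform_limit K h fstar sequentially))"
proof -
  obtain K0 where "dens_op_eigenfunction fstar (1 + (LBINT y:{1..2}. fstar y)) K0"
    using is_fstar_eigenfunction[OF fstar] .
  then interpret dens_op_eigenfunction fstar "1 + (LBINT y:{1..2}. fstar y)" K0 .
  have "continuous_on {0<..2} (\<lambda>x. D * ln x + g x)"
    by (intro continuous_intros continuous_on_subset[OF g]) auto
  then have fc: "continuous_on {0<..2} f" by (subst continuous_on_cong[OF refl f]) auto
  then have adm: "regular_density f" using dens by (auto simp: regular_density_def prob_density_def)
  have one: "(LBINT x:{0<..2}. f x) = 1" using dens by (simp add: prob_density_def)
  have "\<exists>y\<in>{0<..2}. f y \<noteq> 0"
  proof (rule ccontr)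
    assume "\<not> ?thesis"
    then have "(LBINT x:{0<..2}. f x) = (LBINT x:{0<..2::real}. 0)"
      by (intro set_lebesgue_integral_cong) auto
    then show False using one by simp
  qed
  then obtain y where nz: "y \<in> {0<..2}" "f y \<noteq> 0" by blast
  obtain B where B: "0 < B" "\<And>x. x \<in> {0..2} \<Longrightarrow> \<bar>g x\<bar> \<le> B"
    using compact_imp_bounded[OF compact_continuous_image[OF g compact_Icc]]
    unfolding bounded_pos by force
  obtain c where c: "0 < c" "\<And>x. x \<in> {0<..2} \<Longrightarrow> c * (1 + (ln 2 - ln x)) \<le> fstar x"
    using lower by blast
  \<comment> \<open>Both \<open>\<bar>ln x\<bar>\<close> and 1 are at most the logarithmic weight,
    which in turn is at most \<open>fstar x / c\<close>.\<close>
  have M: "f x \<le> (\<bar>D\<bar> + B) / c * fstar x" if x: "x \<in> {0<..2}" for x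
  proof -
    have l: "ln x \<le> ln 2" using x by simp
    moreover have "0 \<le> ln (2::real)" by simp
    ultimately have w: "\<bar>ln x\<bar> \<le> 1 + (ln 2 - ln x)"
      using ln_le_minus_one[of 2] by (auto simp: abs_le_iff)
    have "D * ln x \<le> \<bar>D\<bar> * \<bar>ln x\<bar>" by (simp flip: abs_mult)
    also have "\<dots> \<le> \<bar>D\<bar> * (1 + (ln 2 - ln x))" using w by (intro mult_left_mono) auto
    finally have "D * ln x \<le> \<bar>D\<bar> * (1 + (ln 2 - ln x))" .
    moreover have "g x \<le> B * (1 + (ln 2 - ln x))"
    proof -
      have "g x \<le> B * 1" using B(2)[of x] x by auto
      also have "\<dots> \<le> B * (1 + (ln 2 - ln x))" using l B(1) by (intro mult_left_mono) auto
      finally show ?thesis .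
    qed
    ultimately have "f x \<le> (\<bar>D\<bar> + B) * (1 + (ln 2 - ln x))"
      using f[OF x] by (simp add: algebra_simps)
    also have "\<dots> = (\<bar>D\<bar> + B) / c * (c * (1 + (ln 2 - ln x)))" using c(1) by simp
    also have "\<dots> \<le> (\<bar>D\<bar> + B) / c * fstar x" using c B x by (intro mult_left_mono) auto
    finally show ?thesis .
  qed
  define h where "h n x = (dens_op ^^ n) f x / (LBINT x:{0<..2}. (dens_op ^^ n) f x)" for n x
  have Z: "0 < (LBINT x:{0<..2}. (dens_op ^^ n) f x)" for n
    by (rule iterate_integral_pos[OF adm M nz])
  have h: "continuous_density (h n) ((op_That ^^ n) (dens_measure f))" for n
    using regular_density_divide[OF regular_density_dens_op_pow[OF adm] Z, of n n]
      op_That_pow_dens_measure[OF adm one Z, of n]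
    by (auto simp: continuous_density_def regular_density_def h_def[abs_def])
  have "uniform_limit C k fstar sequentially"
    if k: "\<And>n. continuous_density (k n) ((op_That ^^ n) (dens_measure f))"
      and C: "compact C" "C \<subseteq> {0<..2}" for k C
  proof -
    have "uniform_limit C h fstar sequentially"
      using normalized_iterates_uniform_limit[OF fc regular_densityD(2)[OF adm] M nz C]
      by (simp add: h_def[abs_def])
    moreover have "h n x = k n x" if "x \<in> C" for n x
      using continuous_density_unique[OF h k] that C by auto
    ultimately show ?thesis by (subst uniform_limit_cong'[where g = h and i = fstar]) auto
  qed
  with h show ?thesis by blast
qed

end
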